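(* Let $\Gamma$ be a vertex-transitive directed graph with connectivity one. Then $\Gamma$ is primitive if and only if the blocks of $\Gamma$ are primitive but not automorphism-regular, are pairwise isomorphic, and each has at least three vertices.
   Context: A (directed) graph $\Gamma$ is a pair $(V\Gamma, E\Gamma)$ where $E\Gamma$ is a set of ordered pairs of distinct elements of $V\Gamma$ (no loops or multiple edges; both $(\alpha,\beta)$ and $(\beta,\alpha)$ may be edges). Two vertices $\alpha,\beta$ are adjacent if $(\alpha,\beta)\in E\Gamma$ or $(\beta,\alpha)\in E\Gamma$. All paths are undirected (consecutive vertices are adjacent), and a graph is connected if any two vertices are joined by such a path. A graph $\Gamma$ has connectivity one if it is connected and there is a vertex $\alpha$ such that the induced graph $\Gamma\setminus\{\alpha\}$ is not connected. A block of $\Gamma$ is a connected subgraph that is maximal subject to the condition that it does not have connectivity one. An automorphism of $\Gamma$ is a permutation of $V\Gamma$ that preserves $E\Gamma$ and its complement (so edge directions are preserved); $\mathrm{Aut}\,\Gamma$ is the group of all automorphisms, and isomorphisms of graphs likewise preserve edge directions. A group of permutations $G$ of a set $\Omega$ is primitive if it is transitive on $\Omega$ and the only $G$-invariant equivalence relations on $\Omega$ are the trivial one (equality) and the universal one. A graph $\Gamma$ is vertex-transitive (respectively primitive) if $\mathrm{Aut}\,\Gamma$ acts transitively (respectively primitively) on $V\Gamma$. A graph $\Lambda$ is automorphism-regular if $\mathrm{Aut}\,\Lambda$ acts regularly on $V\Lambda$, i.e. transitively with trivial vertex stabilisers. *)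

theory Defs
  imports "HOL-Algebra.Group_Action" "Graph_Theory.Digraph_Isomorphism"
begin

section \<open>Connectivity one and blocks\<close>

text \<open>
  Paths ignore the direction of arcs, hence the passage to the symmetric closure. Unlike the
  constant \<^const>\<open>connected\<close> of the graph library, the null graph is connected here, so
  that a graph with a single vertex does not have connectivity one.
\<close>

definition undirected_connected :: "('a, 'b) pre_digraph \<Rightarrow> bool" where
  "undirected_connected G \<longleftrightarrow> (\<forall>u \<in> verts G. \<forall>v \<in> verts G. u \<rightarrow>\<^sup>*\<^bsub>with_proj (mk_symmetric G)\<^esub> v)"

definition connectivity_one :: "('a, 'b) pre_digraph \<Rightarrow> bool" where
  "connectivity_one G \<longleftrightarrow> undirected_connected G \<and>
     (\<exists>v \<in> verts G. \<not> undirected_connected (pre_digraph.del_vert G v))"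

text \<open>
  Maximality is with respect to the subgraph relation and ranges over all subgraphs, induced or not.
\<close>

definition blocks :: "'a pair_pre_digraph \<Rightarrow> 'a pair_pre_digraph set" where
  "blocks G = {B. pre_digraph.max_subgraph (with_proj G)
     (\<lambda>H. undirected_connected H \<and> \<not> connectivity_one H) (with_proj B)}"

section \<open>Primitive groups of permutations\<close>

text \<open>Here \<open>G\<close> is a subgroup of \<^term>\<open>BijGroup S\<close>, acting on \<open>S\<close> by application.\<close>

definition transitive_perm_group :: "('a \<Rightarrow> 'a) monoid \<Rightarrow> 'a set \<Rightarrow> bool" where
  "transitive_perm_group G S \<longleftrightarrow> transitive_action G S (\<lambda>g. g)"

definition primitive_perm_group :: "('a \<Rightarrow> 'a) monoid \<Rightarrow> 'a set \<Rightarrow> bool" where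
  "primitive_perm_group G S \<longleftrightarrow> transitive_perm_group G S \<and>
     (\<forall>r. equiv S r \<and> (\<forall>g \<in> carrier G. \<forall>x y. (x, y) \<in> r \<longrightarrow> (g x, g y) \<in> r)
        \<longrightarrow> r = Id_on S \<or> r = S \<times> S)"

definition regular_perm_group :: "('a \<Rightarrow> 'a) monoid \<Rightarrow> 'a set \<Rightarrow> bool" where
  "regular_perm_group G S \<longleftrightarrow> transitive_perm_group G S \<and>
     (\<forall>x \<in> S. stabilizer G (\<lambda>g. g) x = {\<one>\<^bsub>G\<^esub>})"

section \<open>Automorphisms of digraphs\<close>

definition graph_auts :: "'a pair_pre_digraph \<Rightarrow> ('a \<Rightarrow> 'a) set" where
  "graph_auts G = {f \<in> Bij (pverts G).
     \<forall>u \<in> pverts G. \<forall>v \<in> pverts G. (f u, f v) \<in> parcs G \<longleftrightarrow> (u, v) \<in> parcs G}"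

definition Aut :: "'a pair_pre_digraph \<Rightarrow> ('a \<Rightarrow> 'a) monoid" where
  "Aut G = BijGroup (pverts G) \<lparr>carrier := graph_auts G\<rparr>"

lemma subgroup_graph_auts: "subgroup (graph_auts G) (BijGroup (pverts G))"
proof (rule group.subgroupI[OF group_BijGroup])
  show "graph_auts G \<subseteq> carrier (BijGroup (pverts G))"
    by (auto simp: graph_auts_def BijGroup_def)
  have "(\<lambda>x \<in> pverts G. x) \<in> graph_auts G"
    by (auto simp: graph_auts_def id_Bij)
  then show "graph_auts G \<noteq> {}" by blast
next
  fix f assume f: "f \<in> graph_auts G"
  then have fB: "f \<in> Bij (pverts G)" by (simp add: graph_auts_def)
  then have surj: "f ` pverts G = pverts G" by (simp add: Bij_def bij_betw_def)
  have "(inv_into (pverts G) f u, inv_into (pverts G) f v) \<in> parcs G \<longleftrightarrow> (u, v) \<in> parcs G"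
    if "u \<in> pverts G" "v \<in> pverts G" for u v
  proof -
    have "inv_into (pverts G) f u \<in> pverts G" "f (inv_into (pverts G) f u) = u"
      "inv_into (pverts G) f v \<in> pverts G" "f (inv_into (pverts G) f v) = v"
      using that surj by (auto simp: inv_into_into f_inv_into_f)
    then show ?thesis using f unfolding graph_auts_def by force
  qed
  then show "inv\<^bsub>BijGroup (pverts G)\<^esub> f \<in> graph_auts G"
    using fB by (simp add: inv_BijGroup graph_auts_def restrict_inv_into_Bij)
next
  fix f g assume f: "f \<in> graph_auts G" and g: "g \<in> graph_auts G"
  then have "f \<in> Bij (pverts G)" "g \<in> Bij (pverts G)" by (simp_all add: graph_auts_def)
  moreover from this have "g u \<in> pverts G" if "u \<in> pverts G" for u
    using that by (auto simp: Bij_def bij_betw_def)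
  ultimately show "f \<otimes>\<^bsub>BijGroup (pverts G)\<^esub> g \<in> graph_auts G"
    using f g by (simp add: graph_auts_def BijGroup_def compose_Bij compose_eq)
qed

lemma group_Aut: "group (Aut G)"
  unfolding Aut_def
  by (rule subgroup.subgroup_is_group[OF subgroup_graph_auts group_BijGroup])

lemma group_action_Aut: "group_action (Aut G) (pverts G) (\<lambda>g. g)"
proof -
  have "(\<lambda>g. g) \<in> hom (Aut G) (BijGroup (pverts G))"
    using subgroup.subset[OF subgroup_graph_auts[of G]]
    by (auto simp: hom_def Aut_def)
  then show ?thesis
    by (simp add: group_action_def group_hom_def group_hom_axioms_def group_Aut group_BijGroup)
qed

definition vertex_transitive :: "'a pair_pre_digraph \<Rightarrow> bool" where
  "vertex_transitive G \<longleftrightarrow> transitive_perm_group (Aut G) (pverts G)"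

definition primitive_graph :: "'a pair_pre_digraph \<Rightarrow> bool" where
  "primitive_graph G \<longleftrightarrow> primitive_perm_group (Aut G) (pverts G)"

definition automorphism_regular :: "'a pair_pre_digraph \<Rightarrow> bool" where
  "automorphism_regular G \<longleftrightarrow> regular_perm_group (Aut G) (pverts G)"

end

theory Submission
  imports Defs "HOL-Library.Transitive_Closure_Table" "HOL-Combinatorics.Transposition"
begin

text \<open>
  The vertices and the blocks of a connected graph, joined by incidence, form a tree. Concretely,
  every vertex \<open>v\<close> has a gate in each block \<open>D\<close>, the vertex of \<open>D\<close> at which paths from \<open>v\<close> enter \<open>D\<close>
  (\<open>gate_unique\<close>), and all vertices of another block have the same gate in \<open>D\<close>
  (\<open>gate_constant_on_other_block\<close>). Because a tree has no cycles, data on vertices and blocks that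
  can be extended across each single incidence can be chosen consistently everywhere
  (\<open>block_tree_choice\<close>).

  Let the digraph be primitive. An invariant family of equivalence relations on the blocks
  generates an invariant equivalence relation on the vertices, and the gates show that within each
  block nothing new gets related. So such a family is trivial, in the same way on all blocks
  (\<open>invariant_block_relations_trivial\<close>). It follows that automorphisms permute the blocks
  transitively, which makes them isomorphic, and that the blocks are primitive as soon as the
  stabiliser of a block is transitive on it. The remaining claims use foldings: if all blocks can be
  mapped onto a set \<open>T\<close> in an invariant way, by maps that are determined by their value at one vertex,
  these maps combine to a map from the vertices to \<open>T\<close> whose fibres are a forbidden invariant
  equivalence relation (\<open>no_invariant_folding\<close>). With two elements in \<open>T\<close> this excludes blocks with
  two vertices and blocks with an intransitive stabiliser; with \<open>T\<close> a block, it excludes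
  automorphism-regular blocks.

  Conversely, let the blocks be as stated. Then every isomorphism between blocks extends to an
  automorphism of the digraph (\<open>extend_block_isomorphism\<close>). Suppose that an invariant equivalence
  relation relates \<open>x\<close> to another vertex \<open>y\<close>. Let \<open>B\<close> be the block at \<open>x\<close> that leads towards \<open>y\<close>, and
  \<open>z\<close> the gate of \<open>y\<close> in \<open>B\<close>. As \<open>B\<close> is primitive but not regular, some automorphism of \<open>B\<close> fixes \<open>z\<close>
  and moves \<open>x\<close> (\<open>primitive_not_regular_moves\<close>). It extends to an automorphism of the digraph that
  fixes everything behind \<open>z\<close>, and \<open>y\<close> in particular, so \<open>x\<close> is related to its image in \<open>B\<close>.
  Primitivity of \<open>B\<close> makes the relation universal on \<open>B\<close>, thus on all blocks, and by connectedness
  everywhere.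
\<close>

section \<open>Blocks of a connected undirected graph\<close>

definition joined :: "('a \<Rightarrow> 'a \<Rightarrow> bool) \<Rightarrow> 'a set \<Rightarrow> 'a \<Rightarrow> 'a \<Rightarrow> bool" where
  "joined adj S = (\<lambda>x y. adj x y \<and> x \<in> S \<and> y \<in> S)\<^sup>*\<^sup>*"

definition connected_on :: "('a \<Rightarrow> 'a \<Rightarrow> bool) \<Rightarrow> 'a set \<Rightarrow> bool" where
  "connected_on adj S \<longleftrightarrow> (\<forall>x\<in>S. \<forall>y\<in>S. joined adj S x y)"

definition nonseparable :: "('a \<Rightarrow> 'a \<Rightarrow> bool) \<Rightarrow> 'a set \<Rightarrow> bool" where
  "nonseparable adj S \<longleftrightarrow> connected_on adj S \<and> (\<forall>v\<in>S. connected_on adj (S - {v}))"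

lemma joined_refl [simp]: "joined adj S x x"
  by (simp add: joined_def)

lemma joined_trans [trans]: "joined adj S x y \<Longrightarrow> joined adj S y z \<Longrightarrow> joined adj S x z"
  by (simp add: joined_def)

lemma joined_edge: "adj x y \<Longrightarrow> x \<in> S \<Longrightarrow> y \<in> S \<Longrightarrow> joined adj S x y"
  by (auto simp: joined_def)

lemma joined_mono: "joined adj S x y \<Longrightarrow> S \<subseteq> T \<Longrightarrow> joined adj T x y"
  unfolding joined_def by (erule rtranclp_mono[THEN predicate2D, rotated]) auto

lemma joined_sym:
  assumes "symp adj" "joined adj S x y"
  shows "joined adj S y x"
proof -
  have "symp (\<lambda>x y. adj x y \<and> x \<in> S \<and> y \<in> S)"
    using assms(1) by (auto simp: symp_def)
  then show ?thesis
    using assms(2) unfolding joined_def by (meson sympD symp_rtranclp)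
qed

lemma joined_in: "joined adj S x y \<Longrightarrow> x \<noteq> y \<Longrightarrow> x \<in> S \<and> y \<in> S"
  unfolding joined_def by (metis (no_types, lifting) converse_rtranclpE rtranclp.cases)

lemma joined_image:
  assumes "joined adj S x y" "\<And>u v. u \<in> S \<Longrightarrow> v \<in> S \<Longrightarrow> adj u v \<Longrightarrow> adj (f u) (f v)"
  shows "joined adj (f ` S) (f x) (f y)"
  using assms(1) unfolding joined_def
proof (induct rule: rtranclp_induct)
  case (step u v)
  then have "adj (f u) (f v) \<and> f u \<in> f ` S \<and> f v \<in> f ` S"
    using assms(2) by blast
  with step(3) show ?case by (rule rtranclp.rtrancl_into_rtrancl)
qed simp

lemma connected_on_attach:
  assumes sym: "symp adj"
    and "connected_on adj X" "X \<subseteq> Y" "\<And>y. y \<in> Y \<Longrightarrow> \<exists>x\<in>X. joined adj Y y x"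
  shows "connected_on adj Y"
  unfolding connected_on_def
proof (intro ballI)
  fix y z assume "y \<in> Y" "z \<in> Y"
  then obtain x x' where x: "x \<in> X" "joined adj Y y x" "x' \<in> X" "joined adj Y z x'"
    using assms(4) by meson
  have "joined adj Y x x'"
    using x assms(2,3) joined_mono unfolding connected_on_def by metis
  then show "joined adj Y y z"
    using x joined_sym[OF sym x(4)] by (meson joined_trans)
qed

lemma connected_on_Un:
  assumes sym: "symp adj"
    and X: "connected_on adj X" and Y: "connected_on adj Y" and "c \<in> X" "c \<in> Y"
  shows "connected_on adj (X \<union> Y)"
proof (rule connected_on_attach[OF sym X])
  fix y assume "y \<in> X \<union> Y"
  then show "\<exists>x\<in>X. joined adj (X \<union> Y) y x"
  proof
    assume "y \<in> Y"
    then have "joined adj (X \<union> Y) y c"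
      using Y \<open>c \<in> Y\<close> joined_mono[of adj Y y c] by (auto simp: connected_on_def)
    then show ?thesis using \<open>c \<in> X\<close> by blast
  qed (auto intro: bexI[of _ y])
qed auto

lemma nonseparable_connected: "nonseparable adj S \<Longrightarrow> connected_on adj (S - {v})"
  by (cases "v \<in> S") (auto simp: nonseparable_def)

text \<open>
  After the deletion of any vertex, at least one of the two common vertices is left to hold the two
  connected remainders together.
\<close>

lemma nonseparable_Un:
  assumes sym: "symp adj"
    and S: "nonseparable adj S" and T: "nonseparable adj T"
    and xy: "x \<in> S" "x \<in> T" "y \<in> S" "y \<in> T" "x \<noteq> y"
  shows "nonseparable adj (S \<union> T)"
  unfolding nonseparable_def
proof (intro conjI ballI)
  show "connected_on adj (S \<union> T)"
    using S T xy by (intro connected_on_Un[OF sym]) (auto simp: nonseparable_def)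
  fix v
  obtain c where "c \<in> S - {v}" "c \<in> T - {v}" using xy by blast
  then have "connected_on adj ((S - {v}) \<union> (T - {v}))"
    using S T by (intro connected_on_Un[OF sym] nonseparable_connected)
  then show "connected_on adj (S \<union> T - {v})" by (simp add: Un_Diff)
qed

lemma path_joined_end:
  assumes "rtrancl_path r x xs y" "w \<in> set (x # xs)"
  shows "joined r (set (x # xs)) w y"
  using assms
proof (induct arbitrary: w)
  case (step x y ys z)
  have tail: "joined r (set (x # y # ys)) u z" if "u \<in> set (y # ys)" for u
    by (rule joined_mono[OF step(3)[OF that]]) auto
  show ?case
  proof (cases "w \<in> set (y # ys)")
    case False
    then have "joined r (set (x # y # ys)) w y"
      using step by (auto intro: joined_edge)
    then show ?thesis using tail by (meson joined_trans list.set_intros(1))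
  qed (rule tail)
qed simp

text \<open>
  The vertices before the deleted one stay joined to the start of the path, those after it to the
  end.
\<close>

lemma simple_path_delete_vertex:
  assumes "rtrancl_path r x xs y" "distinct (x # xs)" "w \<in> set (x # xs)" "v \<noteq> w"
  shows "joined r (set (x # xs) - {v}) x w \<or> joined r (set (x # xs) - {v}) w y"
  using assms
proof (induct arbitrary: w)
  case (step x y ys z)
  let ?P = "set (x # y # ys) - {v}"
  show ?case
  proof (cases "w = x")
    case False
    then have w: "w \<in> set (y # ys)" using step by auto
    consider "v = x" | "v \<noteq> x" "joined r (set (y # ys) - {v}) y w"
      | "joined r (set (y # ys) - {v}) w z"
      using step w by force
    then show ?thesis
    proof cases
      case 1
      have "set (y # ys) \<subseteq> ?P" using 1 step by auto
      then show ?thesis using joined_mono[OF path_joined_end[OF step(2) w]] by blast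
    next
      case 2
      have yv: "y \<noteq> v" using joined_in[OF 2(2)] step(6) by (metis Diff_iff singletonI)
      then have "joined r ?P x y" using step 2 by (auto intro: joined_edge)
      moreover have "joined r ?P y w" by (rule joined_mono[OF 2(2)]) auto
      ultimately show ?thesis by (meson joined_trans)
    next
      case 3
      have "joined r ?P w z" by (rule joined_mono[OF 3]) auto
      then show ?thesis ..
    qed
  qed simp
qed simp

locale connected_ugraph =
  fixes V :: "'a set" and adj :: "'a \<Rightarrow> 'a \<Rightarrow> bool"
  assumes symp_adj: "symp adj"
    and adj_irrefl: "\<not> adj x x"
    and adj_in_V: "adj x y \<Longrightarrow> x \<in> V"
    and connected_V: "connected_on adj V"
    and two_vertices: "\<exists>x\<in>V. \<exists>y\<in>V. x \<noteq> y"
begin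

lemma adj_sym: "adj x y \<Longrightarrow> adj y x"
  using symp_adj by (auto dest: sympD)

definition block_sets :: "'a set set" where
  "block_sets = {S. S \<subseteq> V \<and> nonseparable adj S \<and>
     (\<forall>T. T \<subseteq> V \<and> nonseparable adj T \<and> S \<subseteq> T \<longrightarrow> T = S)}"

lemma block_sets_subset: "D \<in> block_sets \<Longrightarrow> D \<subseteq> V"
  and block_sets_nonseparable: "D \<in> block_sets \<Longrightarrow> nonseparable adj D"
  by (auto simp: block_sets_def)

lemma block_setsD: "D \<in> block_sets \<Longrightarrow> x \<in> D \<Longrightarrow> x \<in> V"
  by (auto simp: block_sets_def)

lemma block_sets_maximal:
  "D \<in> block_sets \<Longrightarrow> nonseparable adj T \<Longrightarrow> T \<subseteq> V \<Longrightarrow> D \<subseteq> T \<Longrightarrow> T = D"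
  by (auto simp: block_sets_def)

lemma block_sets_eqI:
  assumes "D \<in> block_sets" "D' \<in> block_sets" "x \<in> D" "x \<in> D'" "y \<in> D" "y \<in> D'" "x \<noteq> y"
  shows "D = D'"
proof -
  have "nonseparable adj (D \<union> D')"
    using assms by (intro nonseparable_Un[OF symp_adj, where x=x and y=y]) (auto simp: block_sets_def)
  then have "D \<union> D' = D" "D \<union> D' = D'"
    using assms block_sets_maximal[of D "D \<union> D'"] block_sets_maximal[of D' "D \<union> D'"]
      block_sets_subset[of D] block_sets_subset[of D'] by blast+
  then show ?thesis by simp
qed

text \<open>
  Any two nonseparable sets containing both ends of an edge have a nonseparable union, so the
  union of all of them is nonseparable as well; this union is the block of the edge.
\<close>

lemma edge_in_block:
  assumes "adj x y"
  shows "\<exists>D\<in>block_sets. x \<in> D \<and> y \<in> D"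
proof -
  define \<F> where "\<F> = {T. T \<subseteq> V \<and> nonseparable adj T \<and> x \<in> T \<and> y \<in> T}"
  have xy: "x \<noteq> y" "x \<in> V" "y \<in> V" "adj y x"
    using assms adj_irrefl adj_in_V adj_sym by blast+
  have un: "S \<union> T \<in> \<F>" if "S \<in> \<F>" "T \<in> \<F>" for S T
    using that nonseparable_Un[OF symp_adj, where S=S and T=T and x=x and y=y] xy by (auto simp: \<F>_def)
  have "nonseparable adj {x, y}"
  proof -
    have "connected_on adj {x, y}"
      using assms xy by (auto simp: connected_on_def intro: joined_edge)
    moreover have "connected_on adj ({x, y} - {v})" if "v \<in> {x, y}" for v
      using that xy by (auto simp: connected_on_def)
    ultimately show ?thesis by (auto simp: nonseparable_def)
  qed
  then have xyF: "{x, y} \<in> \<F>" using xy by (auto simp: \<F>_def)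
  have "connected_on adj (\<Union>\<F> - {v})" for v
    unfolding connected_on_def
  proof (intro ballI)
    fix u w assume "u \<in> \<Union>\<F> - {v}" "w \<in> \<Union>\<F> - {v}"
    then obtain S T where ST: "S \<in> \<F>" "T \<in> \<F>" and "u \<in> S - {v}" "w \<in> T - {v}" by blast
    moreover have "connected_on adj (S \<union> T - {v})"
      using un[OF ST] nonseparable_connected by (auto simp: \<F>_def)
    ultimately have "joined adj (S \<union> T - {v}) u w"
      unfolding connected_on_def by blast
    then show "joined adj (\<Union>\<F> - {v}) u w" by (rule joined_mono) (use ST in auto)
  qed
  moreover have "connected_on adj (\<Union>\<F>)"
    unfolding connected_on_def
  proof (intro ballI)
    fix u w assume "u \<in> \<Union>\<F>" "w \<in> \<Union>\<F>"
    then obtain S T where ST: "S \<in> \<F>" "T \<in> \<F>" and "u \<in> S" "w \<in> T" by blast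
    then have "joined adj (S \<union> T) u w"
      using un[OF ST] by (auto simp: \<F>_def nonseparable_def connected_on_def)
    then show "joined adj (\<Union>\<F>) u w" by (rule joined_mono) (use ST in auto)
  qed
  ultimately have "nonseparable adj (\<Union>\<F>)" by (auto simp: nonseparable_def)
  moreover have "\<Union>\<F> \<subseteq> V" by (auto simp: \<F>_def)
  moreover have "T = \<Union>\<F>" if "T \<subseteq> V" "nonseparable adj T" "\<Union>\<F> \<subseteq> T" for T
  proof -
    have "{x, y} \<subseteq> T" using that(3) xyF by blast
    then have "T \<in> \<F>" using that by (simp add: \<F>_def)
    then show ?thesis using that(3) by blast
  qed
  ultimately have "\<Union>\<F> \<in> block_sets"
    by (simp add: block_sets_def)
  then show ?thesis using xyF by blast
qed

lemma exists_neighbour: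
  assumes "x \<in> V" shows "\<exists>y. adj x y"
proof -
  obtain y where "y \<in> V" "y \<noteq> x" using two_vertices by metis
  then have "(\<lambda>u v. adj u v \<and> u \<in> V \<and> v \<in> V)\<^sup>*\<^sup>* x y"
    using connected_V assms by (auto simp: connected_on_def joined_def)
  then show ?thesis using \<open>y \<noteq> x\<close> by (cases rule: converse_rtranclpE) auto
qed

lemma vertex_in_block: "x \<in> V \<Longrightarrow> \<exists>D\<in>block_sets. x \<in> D"
  using exists_neighbour edge_in_block by blast

text \<open>
  A block with at most one vertex would be properly contained in the block of some edge.
\<close>

lemma block_has_other:
  assumes D: "D \<in> block_sets"
  shows "\<exists>y\<in>D. y \<noteq> x"
proof (rule ccontr)
  assume "\<not> ?thesis"
  then have "D \<subseteq> {x}" by auto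
  obtain z where z: "z \<in> V" "D \<subseteq> {z}"
    using two_vertices \<open>D \<subseteq> {x}\<close> block_setsD[OF D] by (cases "D = {}") auto
  then obtain y E where "adj z y" "E \<in> block_sets" "z \<in> E" "y \<in> E"
    using exists_neighbour edge_in_block by meson
  then have "E = D" "y \<noteq> z"
    using z adj_irrefl block_sets_maximal[OF D, of E] block_sets_nonseparable block_sets_subset
    by blast+
  then show False using \<open>y \<in> E\<close> z by auto
qed

text \<open>
  Every edge lies in a block, so what spreads within blocks spreads along paths.
\<close>

lemma block_induct:
  assumes "z \<in> V" "P z"
    and step: "\<And>D x y. D \<in> block_sets \<Longrightarrow> x \<in> D \<Longrightarrow> y \<in> D \<Longrightarrow> P x \<Longrightarrow> P y"
    and "v \<in> V"
  shows "P v"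
proof -
  have "joined adj V z v" using connected_V assms(1,4) by (auto simp: connected_on_def)
  then show "P v" unfolding joined_def
  proof (induct rule: rtranclp_induct)
    case base
    show ?case by (rule \<open>P z\<close>)
  next
    case (step x y)
    then obtain D where "D \<in> block_sets" "x \<in> D" "y \<in> D" using edge_in_block by blast
    then show ?case using step(3) by (rule assms(3))
  qed
qed

subsection \<open>The gate of a block\<close>

text \<open>
  The gate is the first vertex of the block on a path from \<open>v\<close> to it.
\<close>

lemma exists_gate:
  assumes D: "D \<in> block_sets" and "v \<in> V"
  shows "\<exists>c\<in>D. joined adj (V - D \<union> {c}) v c"
proof -
  obtain d where d: "d \<in> D" using block_has_other[OF D] by blast
  then have "joined adj V v d"
    using connected_V \<open>v \<in> V\<close> block_setsD[OF D] by (auto simp: connected_on_def)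
  then show ?thesis unfolding joined_def[of adj V]
  proof (induct rule: converse_rtranclp_induct)
    case base
    show ?case using d by (intro bexI[of _ d]) auto
  next
    case (step u w)
    then obtain c where c: "c \<in> D" "joined adj (V - D \<union> {c}) w c" by blast
    show ?case
    proof (cases "u \<in> D")
      case True
      then show ?thesis by (intro bexI[of _ u]) auto
    next
      case u: False
      show ?thesis
      proof (cases "w \<in> D")
        case True
        then show ?thesis using step(1) u by (intro bexI[of _ w] joined_edge) auto
      next
        case False
        then have "joined adj (V - D \<union> {c}) u w" using step(1) u by (intro joined_edge) auto
        then show ?thesis using c by (meson joined_trans)
      qed
    qed
  qed
qed

text \<open>
  A path leaving the block at one vertex and returning at another could be added to the block as
  an ear, contradicting maximality.
\<close>

lemma gate_unique:
  assumes D: "D \<in> block_sets" and c: "c \<in> D" "joined adj (V - D \<union> {c}) v c"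
    and c': "c' \<in> D" "joined adj (V - D \<union> {c'}) v c'"
  shows "c = c'"
proof (rule ccontr)
  assume neq: "c \<noteq> c'"
  let ?W = "V - D \<union> {c, c'}"
  \<comment> \<open>Edges inside the block are excluded, so that the path below does leave it.\<close>
  define r where "r = (\<lambda>x y. adj x y \<and> x \<in> ?W \<and> y \<in> ?W \<and> \<not> (x \<in> D \<and> y \<in> D))"
  have r_sym: "r y x" if "r x y" for x y using that adj_sym by (auto simp: r_def)
  have toR: "r\<^sup>*\<^sup>* v d" if "joined adj (V - D \<union> {d}) v d" "d \<in> {c, c'}" for d
    using that(1) unfolding joined_def
    by (rule rtranclp_mono[THEN predicate2D, rotated]) (use that(2) adj_irrefl c c' in \<open>auto simp: r_def\<close>)
  have "r\<^sup>*\<^sup>* c v" using toR[of c] c(2) r_sym by (metis insertI1 symp_rtranclp sympD sympI)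
  also have "r\<^sup>*\<^sup>* v c'" using toR[of c'] c'(2) by simp
  finally obtain xs where path: "rtrancl_path r c xs c'" and dist: "distinct (c # xs)"
    by (metis rtranclp_eq_rtrancl_path rtrancl_path_distinct)
  let ?P = "set (c # xs)"
  have to_adj: "joined adj (S \<inter> V) x y" if "joined r S x y" for S x y
    using that unfolding joined_def
    by (rule rtranclp_mono[THEN predicate2D, rotated]) (auto simp: r_def intro: adj_in_V adj_sym)
  have P_end: "c' \<in> ?P" using path by (induct) auto
  have P_V: "?P \<subseteq> V"
  proof
    fix w assume "w \<in> ?P"
    then have "joined adj (?P \<inter> V) w c'" using path_joined_end[OF path] to_adj by blast
    then show "w \<in> V" using joined_in c' block_setsD[OF D] by (metis IntD2)
  qed
  have ear: "\<exists>x\<in>D - {u}. joined adj (D \<union> ?P - {u}) w x" if "w \<in> D \<union> ?P - {u}" for u w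
  proof (cases "w \<in> D")
    case True then show ?thesis using that by (auto intro: bexI[of _ w])
  next
    case False
    then have w: "w \<in> ?P" "u \<noteq> w" "w \<noteq> c" "w \<noteq> c'" using that c c' by auto
    from simple_path_delete_vertex[OF path dist w(1,2)] show ?thesis
    proof
      assume *: "joined r (?P - {u}) c w"
      then have "joined adj (D \<union> ?P - {u}) c w" using to_adj[OF *] by (rule_tac joined_mono) auto
      moreover have "c \<noteq> u" using joined_in[OF *] w by auto
      ultimately show ?thesis using joined_sym[OF symp_adj] c(1) by blast
    next
      assume *: "joined r (?P - {u}) w c'"
      then have "joined adj (D \<union> ?P - {u}) w c'" using to_adj[OF *] by (rule_tac joined_mono) auto
      moreover have "c' \<noteq> u" using joined_in[OF *] w by auto
      ultimately show ?thesis using c'(1) by blast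
    qed
  qed
  have del: "connected_on adj (D \<union> ?P - {u})" for u
    using ear nonseparable_connected[OF block_sets_nonseparable[OF D]]
    by (rule_tac connected_on_attach[OF symp_adj]) auto
  have "connected_on adj (D \<union> ?P)"
  proof (rule connected_on_attach[OF symp_adj])
    show "connected_on adj D" using block_sets_nonseparable[OF D] by (simp add: nonseparable_def)
    fix w assume "w \<in> D \<union> ?P"
    show "\<exists>x\<in>D. joined adj (D \<union> ?P) w x"
    proof (cases "w \<in> D")
      case False
      then have "joined adj (?P \<inter> V) w c'" using path_joined_end[OF path] to_adj \<open>w \<in> D \<union> ?P\<close> by blast
      then show ?thesis using c' joined_mono[of adj "?P \<inter> V" w c' "D \<union> ?P"] by blast
    qed (auto intro: bexI[of _ w])
  qed auto
  then have "nonseparable adj (D \<union> ?P)" using del by (simp add: nonseparable_def)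
  then have "?P \<subseteq> D" using block_sets_maximal[OF D] P_V block_sets_subset[OF D] by blast
  moreover obtain w where "r c w" "w \<in> ?P" using path neq by cases auto
  ultimately show False using c by (auto simp: r_def)
qed

definition gate :: "'a set \<Rightarrow> 'a \<Rightarrow> 'a" where
  "gate D v = (THE c. c \<in> D \<and> joined adj (V - D \<union> {c}) v c)"

lemma gate_eqI:
  assumes "D \<in> block_sets" "c \<in> D" "joined adj (V - D \<union> {c}) v c"
  shows "gate D v = c"
  unfolding gate_def using assms gate_unique by blast

lemma gate_props:
  assumes "D \<in> block_sets" "v \<in> V"
  shows gate_in: "gate D v \<in> D" and joined_gate: "joined adj (V - D \<union> {gate D v}) v (gate D v)"
  using exists_gate[OF assms] gate_eqI[OF assms(1)] by auto

lemma gate_self: "D \<in> block_sets \<Longrightarrow> v \<in> D \<Longrightarrow> gate D v = v"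
  by (rule gate_eqI) auto

text \<open>
  Another block meets \<open>D\<close> in at most one vertex and is connected, so all of it is attached to
  \<open>D\<close> at the same place.
\<close>

lemma gate_constant_on_other_block:
  assumes D: "D \<in> block_sets" "E \<in> block_sets" "D \<noteq> E" and xy: "x \<in> E" "y \<in> E"
  shows "gate D x = gate D y"
proof -
  have EV: "E \<subseteq> V" using D block_sets_subset by blast
  have conn: "joined adj E u w" if "u \<in> E" "w \<in> E" for u w
    using that block_sets_nonseparable[OF D(2)] by (auto simp: nonseparable_def connected_on_def)
  show ?thesis
  proof (cases "D \<inter> E = {}")
    case True
    let ?c = "gate D y"
    have y: "?c \<in> D" "joined adj (V - D \<union> {?c}) y ?c"
      using gate_props D xy EV by auto
    have "joined adj (V - D \<union> {?c}) x y"
      by (rule joined_mono[OF conn[OF xy]]) (use True EV in blast)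
    then have "joined adj (V - D \<union> {?c}) x ?c" using y(2) by (rule joined_trans)
    then show ?thesis by (rule gate_eqI[OF D(1) y(1)])
  next
    case False
    then obtain c where c: "c \<in> D" "c \<in> E" by blast
    then have "E \<subseteq> V - D \<union> {c}" using block_sets_eqI[OF D(1,2)] D(3) EV by blast
    then have "gate D u = c" if "u \<in> E" for u
      by (rule gate_eqI[OF D(1) c(1) joined_mono[OF conn[OF that c(2)]]])
    then show ?thesis using xy by simp
  qed
qed

text \<open>
  In terms of the tree formed by the vertices and the blocks: of the blocks at \<open>x\<close>, at most one
  leads towards \<open>v\<close>. A path avoiding \<open>x\<close> cannot leave the set of vertices with gate \<open>x\<close> in \<open>D\<close>, and if
  \<open>E\<close> is another block, its gate towards \<open>v\<close> belongs to this set.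
\<close>

lemma block_towards_unique:
  assumes D: "D \<in> block_sets" "E \<in> block_sets" and x: "x \<in> D" "x \<in> E" and "v \<in> V"
    and gates: "gate D v \<noteq> x" "gate E v \<noteq> x"
  shows "D = E"
proof (rule ccontr)
  assume "D \<noteq> E"
  let ?z = "gate E v"
  have "gate D ?z = gate D x"
    by (rule gate_constant_on_other_block[OF D \<open>D \<noteq> E\<close> gate_in[OF D(2) \<open>v \<in> V\<close>] x(2)])
  then have gz: "gate D ?z = x" using gate_self D x by simp
  have "V - E \<union> {?z} \<subseteq> V - {x}"
    using x gates(2) gate_in[OF D(2) \<open>v \<in> V\<close>] block_setsD[OF D(2)] by blast
  then have "joined adj (V - {x}) v ?z"
    by (rule joined_mono[OF joined_gate[OF D(2) \<open>v \<in> V\<close>]])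
  then have "gate D v = x"
    unfolding joined_def
  proof (induct rule: converse_rtranclp_induct)
    case (step u w)
    then obtain C where C: "C \<in> block_sets" "u \<in> C" "w \<in> C" using edge_in_block by blast
    show ?case
    proof (cases "C = D")
      case True
      then have "gate D u = u" "gate D w = w" using C gate_self by auto
      then show ?thesis using step by auto
    next
      case False
      then have "gate D u = gate D w" using gate_constant_on_other_block[OF D(1) C(1) _ C(2,3)] by blast
      then show ?thesis using step by simp
    qed
  qed (rule gz)
  then show False using gates by simp
qed

text \<open>
  If no block at \<open>x\<close> led towards \<open>y\<close>, then \<open>y\<close> would lie behind \<open>x\<close> for every block at \<open>x\<close>; this
  property is shared by all vertices of any block that contains one vertex with it, and thus would
  spread to \<open>x\<close> itself.
\<close>

lemma exists_block_towards:
  assumes "x \<in> V" "y \<in> V" "x \<noteq> y"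
  shows "\<exists>D\<in>block_sets. x \<in> D \<and> gate D y \<noteq> x"
proof (rule ccontr)
  assume neg: "\<not> ?thesis"
  have "x \<noteq> v \<and> (\<forall>D\<in>block_sets. x \<in> D \<longrightarrow> gate D v = x)" if "v \<in> V" for v
  proof (rule block_induct[OF assms(2) _ _ that])
    show "x \<noteq> y \<and> (\<forall>D\<in>block_sets. x \<in> D \<longrightarrow> gate D y = x)" using neg assms by blast
    fix C u w assume C: "C \<in> block_sets" "u \<in> C" "w \<in> C"
      and u: "x \<noteq> u \<and> (\<forall>D\<in>block_sets. x \<in> D \<longrightarrow> gate D u = x)"
    have "x \<notin> C" using C u gate_self by metis
    then have "gate D w = gate D u" if "D \<in> block_sets" "x \<in> D" for D
      using gate_constant_on_other_block[OF that(1) C(1) _ C(3,2)] that(2) by blast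
    then show "x \<noteq> w \<and> (\<forall>D\<in>block_sets. x \<in> D \<longrightarrow> gate D w = x)"
      using u C \<open>x \<notin> C\<close> by auto
  qed
  then show False using assms by blast
qed

end

section \<open>Choosing compatible data along the tree of blocks\<close>

text \<open>
  The value \<open>s0\<close> at the root \<open>r\<close>, passed on from parents to children; the last two arguments are a
  node and a value that reaches it.
\<close>

inductive propagated :: "('n \<Rightarrow> 'n \<Rightarrow> bool) \<Rightarrow> ('n \<Rightarrow> 's \<Rightarrow> 'n \<Rightarrow> 's) \<Rightarrow> 'n \<Rightarrow> 's \<Rightarrow> 'n \<Rightarrow> 's \<Rightarrow> bool"
  for parent next_state r s0 where
  root: "propagated parent next_state r s0 r s0"
| child: "propagated parent next_state r s0 m s \<Longrightarrow> parent m n \<Longrightarrow>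
    propagated parent next_state r s0 n (next_state m s n)"

text \<open>
  Uniqueness of parents makes the value at each node depend only on the unique path from the root,
  so that a choice made once for each parent and child gives a function on the nodes.
\<close>

lemma rooted_tree_choice:
  fixes parent :: "'n \<Rightarrow> 'n \<Rightarrow> bool" and cmp :: "'n \<Rightarrow> 's \<Rightarrow> 'n \<Rightarrow> 's \<Rightarrow> bool"
  assumes parent_unique: "\<And>m m' n. parent m n \<Longrightarrow> parent m' n \<Longrightarrow> m = m'"
    and root_no_parent: "\<And>m. \<not> parent m r"
    and extend: "\<And>m n s. parent m n \<Longrightarrow> s \<in> S m \<Longrightarrow> \<exists>t\<in>S n. cmp m s n t"
    and "s0 \<in> S r"
  shows "\<exists>f. f r = s0 \<and> (\<forall>n. parent\<^sup>*\<^sup>* r n \<longrightarrow> f n \<in> S n) \<and>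
    (\<forall>m n. parent\<^sup>*\<^sup>* r m \<longrightarrow> parent m n \<longrightarrow> cmp m (f m) n (f n))"
proof -
  define nxt where "nxt m s n = (SOME t. t \<in> S n \<and> cmp m s n t)" for m s n
  let ?L = "propagated parent nxt r s0"
  have nxt: "nxt m s n \<in> S n \<and> cmp m s n (nxt m s n)" if "parent m n" "s \<in> S m" for m s n
    unfolding nxt_def by (rule someI_ex) (use extend[OF that] in blast)
  have inS: "s \<in> S n" if "?L n s" for n s
    using that
  proof induct
    case (child m s n)
    then show ?case using nxt[of m n s] by simp
  qed (rule assms(4))
  have ex: "\<exists>s. ?L n s" if "parent\<^sup>*\<^sup>* r n" for n
    using that
  proof induct
    case base
    show ?case by (rule exI, rule propagated.root)
  next
    case (step m n)
    then obtain s where "?L m s" by blast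
    then show ?case using step(2) by (intro exI, rule propagated.child)
  qed
  have unique: "s = t" if "?L n s" "?L n t" for n s t
    using that
  proof (induct arbitrary: t)
    case root
    then show ?case
    proof (cases rule: propagated.cases)
      case (child m s)
      then show ?thesis using root_no_parent by blast
    qed simp
  next
    case (child m s n)
    from child(4) show ?case
    proof (cases rule: propagated.cases)
      case root
      then show ?thesis using child(3) root_no_parent by blast
    next
      case child': (child m' s')
      have "m' = m" by (rule parent_unique[OF child'(3) child.hyps(3)])
      then have "s = s'" using child.hyps(2) child'(2) by blast
      then show ?thesis using child'(1) \<open>m' = m\<close> by simp
    qed
  qed
  define f where "f n = (THE s. ?L n s)" for n
  have f: "?L n (f n)" if n: "parent\<^sup>*\<^sup>* r n" for n
  proof -
    obtain s where s: "?L n s" using ex[OF n] by blast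
    then have "f n = s" unfolding f_def by (rule the_equality) (rule unique[OF _ s])
    then show ?thesis using s by simp
  qed
  show ?thesis
  proof (intro exI[of _ f] conjI allI impI)
    show "f r = s0" by (rule unique[OF f propagated.root]) simp
    show "f n \<in> S n" if "parent\<^sup>*\<^sup>* r n" for n by (rule inS[OF f[OF that]])
    fix m n assume mn: "parent\<^sup>*\<^sup>* r m" "parent m n"
    then have "parent\<^sup>*\<^sup>* r n" by (rule rtranclp.rtrancl_into_rtrancl)
    then have "f n = nxt m (f m) n"
      by (rule unique[OF f propagated.child[OF f[OF mn(1)] mn(2)]])
    then show "cmp m (f m) n (f n)" using nxt[OF mn(2) inS[OF f[OF mn(1)]]] by simp
  qed
qed

context connected_ugraph
begin

text \<open>
  The vertices and the blocks, joined by incidence, form a tree, which is rooted here at the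
  block \<open>B\<close>: the parent of another block is its gate towards \<open>B\<close>. In a tree, data that can be
  extended across every single incidence can be chosen consistently everywhere.
\<close>

lemma block_tree_choice:
  fixes SV :: "'a \<Rightarrow> 's set" and SB :: "'a set \<Rightarrow> 't set"
    and fits :: "'a \<Rightarrow> 'a set \<Rightarrow> 's \<Rightarrow> 't \<Rightarrow> bool"
  assumes B: "B \<in> block_sets" "t0 \<in> SB B"
    and down: "\<forall>D\<in>block_sets. \<forall>x\<in>D. \<forall>s\<in>SV x. \<exists>t\<in>SB D. fits x D s t"
    and up: "\<forall>D\<in>block_sets. \<forall>x\<in>D. \<forall>t\<in>SB D. \<exists>s\<in>SV x. fits x D s t"
  shows "\<exists>\<sigma> \<tau>. \<tau> B = t0 \<and> (\<forall>x\<in>V. \<sigma> x \<in> SV x) \<and> (\<forall>D\<in>block_sets. \<tau> D \<in> SB D) \<and>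
    (\<forall>D\<in>block_sets. \<forall>x\<in>D. fits x D (\<sigma> x) (\<tau> D))"
proof -
  obtain o' where o': "o' \<in> B" using block_has_other[OF B(1)] by blast
  then have oV: "o' \<in> V" using block_setsD B by blast
  define parent :: "'a + 'a set \<Rightarrow> 'a + 'a set \<Rightarrow> bool" where
    "parent = (\<lambda>m n. case (m, n) of
        (Inl x, Inr D) \<Rightarrow> D \<in> block_sets \<and> x \<in> D \<and> D \<noteq> B \<and> gate D o' = x
      | (Inr D, Inl x) \<Rightarrow> D \<in> block_sets \<and> x \<in> D \<and> (D = B \<or> gate D o' \<noteq> x)
      | _ \<Rightarrow> False)"
  define S :: "'a + 'a set \<Rightarrow> ('s + 't) set" where
    "S = (\<lambda>n. case n of Inl x \<Rightarrow> Inl ` SV x | Inr D \<Rightarrow> Inr ` SB D)"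
  define cmp :: "'a + 'a set \<Rightarrow> 's + 't \<Rightarrow> 'a + 'a set \<Rightarrow> 's + 't \<Rightarrow> bool" where
    "cmp = (\<lambda>m s n t. case (m, n) of
        (Inl x, Inr D) \<Rightarrow> fits x D (projl s) (projr t)
      | (Inr D, Inl x) \<Rightarrow> fits x D (projl t) (projr s)
      | _ \<Rightarrow> True)"
  have towards_B: "D = B" if "D \<in> block_sets" "x \<in> D" "x \<in> B" "gate D o' \<noteq> x" for D x
  proof (rule ccontr)
    assume "D \<noteq> B"
    then have "gate D o' = gate D x"
      using gate_constant_on_other_block[OF that(1) B(1) _ o' that(3)] by blast
    then show False using that gate_self by simp
  qed
  have unique: "m = m'" if mn: "parent m n" and m'n: "parent m' n" for m m' n
  proof (cases n)
    case (Inl x)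
    then obtain D D' where D: "m = Inr D" "D \<in> block_sets" "x \<in> D" "D = B \<or> gate D o' \<noteq> x"
      and D': "m' = Inr D'" "D' \<in> block_sets" "x \<in> D'" "D' = B \<or> gate D' o' \<noteq> x"
      using mn m'n by (cases m; cases m') (auto simp: parent_def)
    have "D = D'"
    proof (cases "D = B \<or> D' = B")
      case True
      then show ?thesis using towards_B D D' by metis
    next
      case False
      then show ?thesis
        using block_towards_unique[OF D(2) D'(2) D(3) D'(3) oV] D(4) D'(4) by blast
    qed
    then show ?thesis using D D' by simp
  next
    case (Inr D)
    then show ?thesis using mn m'n by (cases m; cases m') (auto simp: parent_def)
  qed
  have root: "\<not> parent m (Inr B)" for m
    by (cases m) (auto simp: parent_def)
  have ext: "\<exists>t\<in>S n. cmp m s n t" if mn: "parent m n" "s \<in> S m" for m n s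
  proof (cases m)
    case (Inl x)
    then obtain D s' where D: "n = Inr D" "D \<in> block_sets" "x \<in> D" "s = Inl s'" "s' \<in> SV x"
      using mn by (cases n) (auto simp: parent_def S_def)
    then obtain t where "t \<in> SB D" "fits x D s' t" using down by blast
    then show ?thesis using Inl D by (auto simp: S_def cmp_def)
  next
    case (Inr D)
    then obtain x t where x: "n = Inl x" "D \<in> block_sets" "x \<in> D" "s = Inr t" "t \<in> SB D"
      using mn by (cases n) (auto simp: parent_def S_def)
    then obtain s' where "s' \<in> SV x" "fits x D s' t" using up by blast
    then show ?thesis using Inr x by (auto simp: S_def cmp_def)
  qed
  have "\<exists>f. f (Inr B) = Inr t0 \<and> (\<forall>n. parent\<^sup>*\<^sup>* (Inr B) n \<longrightarrow> f n \<in> S n) \<and>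
      (\<forall>m n. parent\<^sup>*\<^sup>* (Inr B) m \<longrightarrow> parent m n \<longrightarrow> cmp m (f m) n (f n))"
  proof (rule rooted_tree_choice)
    show "m = m'" if "parent m n" "parent m' n" for m m' n using that by (rule unique)
    show "\<not> parent m (Inr B)" for m by (rule root)
    show "Inr t0 \<in> S (Inr B)" using B by (simp add: S_def)
    show "\<exists>t\<in>S n. cmp m s n t" if "parent m n" "s \<in> S m" for m n s using that by (rule ext)
  qed
  then obtain f where f: "f (Inr B) = Inr t0" "\<And>n. parent\<^sup>*\<^sup>* (Inr B) n \<Longrightarrow> f n \<in> S n"
      "\<And>m n. parent\<^sup>*\<^sup>* (Inr B) m \<Longrightarrow> parent m n \<Longrightarrow> cmp m (f m) n (f n)"
    by blast
  let ?reach = "parent\<^sup>*\<^sup>* (Inr B)"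
  have up_reach: "?reach m" if "parent m n" "?reach n" for m n
    using that(2)
  proof (cases rule: rtranclp.cases)
    case rtrancl_refl
    then show ?thesis using that(1) root[of m] by simp
  next
    case (rtrancl_into_rtrancl m')
    then show ?thesis using unique[OF that(1), of m'] by simp
  qed
  have oriented: "parent (Inl x) (Inr D) \<or> parent (Inr D) (Inl x)" if "D \<in> block_sets" "x \<in> D" for x D
    using that by (auto simp: parent_def)
  have flag_reach: "?reach (Inl x) \<longleftrightarrow> ?reach (Inr D)" if "D \<in> block_sets" "x \<in> D" for x D
    using oriented[OF that] up_reach by (meson rtranclp.rtrancl_into_rtrancl)
  have reachV: "?reach (Inl x)" if "x \<in> V" for x
  proof (rule block_induct[OF oV _ _ that])
    show "?reach (Inl o')" using flag_reach[OF B(1) o'] by simp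
    show "?reach (Inl y)" if "D \<in> block_sets" "x \<in> D" "y \<in> D" "?reach (Inl x)" for D x y
      using flag_reach that by metis
  qed
  have reachB: "?reach (Inr D)" if "D \<in> block_sets" for D
    using block_has_other[OF that] flag_reach[OF that] reachV block_setsD[OF that] by metis
  show ?thesis
  proof (intro exI[of _ "\<lambda>x. projl (f (Inl x))"] exI[of _ "\<lambda>D. projr (f (Inr D))"] conjI ballI)
    show "projr (f (Inr B)) = t0" using f by simp
    show "projl (f (Inl x)) \<in> SV x" if "x \<in> V" for x
      using f(2)[OF reachV[OF that]] by (auto simp: S_def)
    show "projr (f (Inr D)) \<in> SB D" if "D \<in> block_sets" for D
      using f(2)[OF reachB[OF that]] by (auto simp: S_def)
    show "fits x D (projl (f (Inl x))) (projr (f (Inr D)))" if "D \<in> block_sets" "x \<in> D" for x D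
    proof -
      have "x \<in> V" using that block_setsD by blast
      then show ?thesis
        using oriented[OF that] f(3)[OF reachV, of x "Inr D"] f(3)[OF reachB, of D "Inl x"] that
        by (auto simp: cmp_def)
    qed
  qed
qed

end

section \<open>Isomorphisms between induced subdigraphs\<close>

text \<open>
  In contrast to the elements of \<^const>\<open>graph_auts\<close>, such a map may take any values outside
  \<open>X\<close>, so that plain composition and restriction can be used.
\<close>

definition arc_iso :: "'a rel \<Rightarrow> ('a \<Rightarrow> 'a) \<Rightarrow> 'a set \<Rightarrow> 'a set \<Rightarrow> bool" where
  "arc_iso E f X Y \<longleftrightarrow> bij_betw f X Y \<and>
     (\<forall>u\<in>X. \<forall>v\<in>X. (f u, f v) \<in> E \<longleftrightarrow> (u, v) \<in> E)"

lemma arc_iso_bij: "arc_iso E f X Y \<Longrightarrow> bij_betw f X Y"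
  by (simp add: arc_iso_def)

lemma arc_iso_in: "arc_iso E f X Y \<Longrightarrow> x \<in> X \<Longrightarrow> f x \<in> Y"
  by (auto simp: arc_iso_def bij_betw_def)

lemma arc_iso_eq_iff: "arc_iso E f X Y \<Longrightarrow> x \<in> X \<Longrightarrow> y \<in> X \<Longrightarrow> f x = f y \<longleftrightarrow> x = y"
  by (auto simp: arc_iso_def bij_betw_def inj_on_def)

lemma arc_iso_image: "arc_iso E f X Y \<Longrightarrow> f ` X = Y"
  by (auto simp: arc_iso_def bij_betw_def)

lemma arc_iso_arcs: "arc_iso E f X Y \<Longrightarrow> u \<in> X \<Longrightarrow> v \<in> X \<Longrightarrow> (f u, f v) \<in> E \<longleftrightarrow> (u, v) \<in> E"
  by (auto simp: arc_iso_def)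

lemma arc_iso_id: "arc_iso E (\<lambda>x. x) X X"
  by (auto simp: arc_iso_def bij_betw_def)

lemma arc_iso_comp:
  assumes "arc_iso E f X Y" "arc_iso E g Y Z"
  shows "arc_iso E (\<lambda>x. g (f x)) X Z"
  unfolding arc_iso_def
proof (intro conjI ballI)
  show "bij_betw (\<lambda>x. g (f x)) X Z"
    using bij_betw_trans[OF arc_iso_bij[OF assms(1)] arc_iso_bij[OF assms(2)]] by (simp add: comp_def)
  show "((g (f u), g (f v)) \<in> E) = ((u, v) \<in> E)" if "u \<in> X" "v \<in> X" for u v
    using that assms arc_iso_in[OF assms(1)] by (simp add: arc_iso_arcs[OF assms(1)] arc_iso_arcs[OF assms(2)])
qed

lemma arc_iso_inv:
  assumes "arc_iso E f X Y"
  shows "arc_iso E (inv_into X f) Y X"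
  unfolding arc_iso_def
proof (intro conjI ballI)
  show bij: "bij_betw (inv_into X f) Y X" by (rule bij_betw_inv_into[OF arc_iso_bij[OF assms]])
  fix u v assume uv: "u \<in> Y" "v \<in> Y"
  then have "inv_into X f u \<in> X" "inv_into X f v \<in> X"
    using bij by (auto simp: bij_betw_def)
  then show "((inv_into X f u, inv_into X f v) \<in> E) = ((u, v) \<in> E)"
    using arc_iso_arcs[OF assms, of "inv_into X f u" "inv_into X f v"] uv
      bij_betw_inv_into_right[OF arc_iso_bij[OF assms]] by simp
qed

lemma arc_iso_inv_left: "arc_iso E f X Y \<Longrightarrow> x \<in> X \<Longrightarrow> inv_into X f (f x) = x"
  by (meson arc_iso_bij bij_betw_inv_into_left)

lemma arc_iso_inv_right: "arc_iso E f X Y \<Longrightarrow> y \<in> Y \<Longrightarrow> f (inv_into X f y) = y"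
  by (meson arc_iso_bij bij_betw_inv_into_right)

lemma arc_iso_subset:
  assumes "arc_iso E f X Y" "S \<subseteq> X"
  shows "arc_iso E f S (f ` S)"
  using assms unfolding arc_iso_def by (auto intro: bij_betw_subset)

lemma arc_iso_cong:
  assumes "arc_iso E f X Y" "\<And>x. x \<in> X \<Longrightarrow> g x = f x"
  shows "arc_iso E g X Y"
  using assms(1) bij_betw_cong[of X g f Y, OF assms(2)] assms(2) unfolding arc_iso_def by auto

definition induced :: "'a pair_pre_digraph \<Rightarrow> 'a set \<Rightarrow> 'a pair_pre_digraph" where
  "induced G S = \<lparr>pverts = S, parcs = parcs G \<inter> S \<times> S\<rparr>"

lemma induced_simps [simp]:
  "pverts (induced G S) = S" "parcs (induced G S) = parcs G \<inter> S \<times> S"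
  by (simp_all add: induced_def)

text \<open>
  The translations below replace the extensional permutations that form \<^const>\<open>Aut\<close> by maps that
  are isomorphisms on the vertex set; restricting such a map makes it extensional.
\<close>

lemma graph_auts_induced: "graph_auts (induced G S) = {f \<in> extensional S. arc_iso (parcs G) f S S}"
  by (auto simp: graph_auts_def arc_iso_def Bij_def dest: bij_betwE)

lemma carrier_Aut: "carrier (Aut G) = graph_auts G"
  by (simp add: Aut_def)

lemma vertex_transitive_induced:
  "vertex_transitive (induced G S) \<longleftrightarrow> (\<forall>x\<in>S. \<forall>y\<in>S. \<exists>f. arc_iso (parcs G) f S S \<and> f x = y)"
proof -
  have "vertex_transitive (induced G S) \<longleftrightarrow>
      (\<forall>x\<in>S. \<forall>y\<in>S. \<exists>f\<in>graph_auts (induced G S). f x = y)"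
    using group_action_Aut[of "induced G S"]
    by (auto simp: vertex_transitive_def transitive_perm_group_def transitive_action_def
        transitive_action_axioms_def carrier_Aut)
  also have "\<dots> \<longleftrightarrow> (\<forall>x\<in>S. \<forall>y\<in>S. \<exists>f. arc_iso (parcs G) f S S \<and> f x = y)"
  proof (intro ball_cong refl iffI)
    fix x y assume "x \<in> S" "y \<in> S" "\<exists>f. arc_iso (parcs G) f S S \<and> f x = y"
    then obtain f where "arc_iso (parcs G) f S S" "f x = y" by blast
    then show "\<exists>f\<in>graph_auts (induced G S). f x = y"
      using arc_iso_cong[of "parcs G" f S S "restrict f S"] \<open>x \<in> S\<close>
      by (intro bexI[of _ "restrict f S"]) (auto simp: graph_auts_induced)
  qed (auto simp: graph_auts_induced)
  finally show ?thesis .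
qed

definition invariant_equiv :: "'a rel \<Rightarrow> 'a set \<Rightarrow> 'a rel \<Rightarrow> bool" where
  "invariant_equiv E S r \<longleftrightarrow> equiv S r \<and>
     (\<forall>f. arc_iso E f S S \<longrightarrow> (\<forall>x y. (x, y) \<in> r \<longrightarrow> (f x, f y) \<in> r))"

lemma primitive_graph_induced:
  "primitive_graph (induced G S) \<longleftrightarrow> vertex_transitive (induced G S) \<and>
     (\<forall>r. invariant_equiv (parcs G) S r \<longrightarrow> r = Id_on S \<or> r = S \<times> S)"
proof -
  have "equiv S r \<and> (\<forall>g\<in>graph_auts (induced G S). \<forall>x y. (x, y) \<in> r \<longrightarrow> (g x, g y) \<in> r)
      \<longleftrightarrow> invariant_equiv (parcs G) S r" for r
  proof
    assume r: "equiv S r \<and> (\<forall>g\<in>graph_auts (induced G S). \<forall>x y. (x, y) \<in> r \<longrightarrow> (g x, g y) \<in> r)"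
    then have rS: "r \<subseteq> S \<times> S" by (simp add: equiv_def refl_on_def)
    have "(f x, f y) \<in> r" if "arc_iso (parcs G) f S S" "(x, y) \<in> r" for f x y
    proof -
      have "restrict f S \<in> graph_auts (induced G S)"
        using arc_iso_cong[OF that(1), of "restrict f S"] by (auto simp: graph_auts_induced)
      then have "(restrict f S x, restrict f S y) \<in> r" using r that(2) by blast
      then show ?thesis using that(2) rS by auto
    qed
    then show "invariant_equiv (parcs G) S r" using r by (auto simp: invariant_equiv_def)
  qed (auto simp: invariant_equiv_def graph_auts_induced)
  then show ?thesis
    by (simp add: primitive_graph_def primitive_perm_group_def vertex_transitive_def carrier_Aut)
qed

lemma automorphism_regular_induced:
  "automorphism_regular (induced G S) \<longleftrightarrow> vertex_transitive (induced G S) \<and>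
     (\<forall>f. \<forall>x\<in>S. arc_iso (parcs G) f S S \<longrightarrow> f x = x \<longrightarrow> (\<forall>y\<in>S. f y = y))"
proof -
  have one: "\<one>\<^bsub>Aut (induced G S)\<^esub> = (\<lambda>x\<in>S. x)"
    by (simp add: Aut_def BijGroup_def)
  have id: "(\<lambda>x\<in>S. x) \<in> graph_auts (induced G S)"
    using arc_iso_cong[OF arc_iso_id, of S "\<lambda>x\<in>S. x"] by (auto simp: graph_auts_induced)
  have "stabilizer (Aut (induced G S)) (\<lambda>g. g) x = {\<one>\<^bsub>Aut (induced G S)\<^esub>} \<longleftrightarrow>
      (\<forall>f. arc_iso (parcs G) f S S \<longrightarrow> f x = x \<longrightarrow> (\<forall>y\<in>S. f y = y))" (is "?L \<longleftrightarrow> ?R") if x: "x \<in> S" for x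
  proof
    assume ?L
    show ?R
    proof (intro allI impI ballI)
      fix f y assume f: "arc_iso (parcs G) f S S" "f x = x" and y: "y \<in> S"
      have "restrict f S \<in> graph_auts (induced G S)"
        using arc_iso_cong[OF f(1), of "restrict f S"] by (auto simp: graph_auts_induced)
      then have "restrict f S \<in> stabilizer (Aut (induced G S)) (\<lambda>g. g) x"
        using f x by (simp add: stabilizer_def carrier_Aut)
      then have "restrict f S = (\<lambda>x\<in>S. x)" using \<open>?L\<close> one by simp
      then have "restrict f S y = (\<lambda>x\<in>S. x) y" by (rule fun_cong)
      then show "f y = y" using y by simp
    qed
  next
    assume ?R
    have "f = (\<lambda>x\<in>S. x)" if "f \<in> graph_auts (induced G S)" "f x = x" for f
    proof (rule extensionalityI[of _ S])
      have f: "f \<in> extensional S" "arc_iso (parcs G) f S S" using that by (auto simp: graph_auts_induced)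
      show "f \<in> extensional S" by (rule f)
      show "f y = (\<lambda>x\<in>S. x) y" if "y \<in> S" for y
        using \<open>?R\<close>[rule_format, OF f(2) \<open>f x = x\<close> that] that by simp
    qed simp
    then have "{g \<in> graph_auts (induced G S). g x = x} \<subseteq> {\<lambda>x\<in>S. x}" by blast
    then show ?L using id x unfolding stabilizer_def carrier_Aut one by auto
  qed
  then have "(\<forall>x\<in>S. stabilizer (Aut (induced G S)) (\<lambda>g. g) x = {\<one>\<^bsub>Aut (induced G S)\<^esub>}) \<longleftrightarrow>
      (\<forall>x\<in>S. \<forall>f. arc_iso (parcs G) f S S \<longrightarrow> f x = x \<longrightarrow> (\<forall>y\<in>S. f y = y))"
    by (rule ball_cong[OF refl])
  then show ?thesis
    unfolding automorphism_regular_def regular_perm_group_def vertex_transitive_def induced_simps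
    by blast
qed

text \<open>
  An isomorphism of digraphs has separate maps for vertices and arcs, but here an arc is the pair of
  its ends, so the vertex map determines it.
\<close>

lemma digraph_iso_induced:
  fixes G :: "'a pair_pre_digraph" and S T :: "'a set"
  shows "digraph_iso (with_proj (induced G S)) (with_proj (induced G T)) \<longleftrightarrow> (\<exists>f. arc_iso (parcs G) f S T)"
proof
  assume "digraph_iso (with_proj (induced G S)) (with_proj (induced G T))"
  then obtain h where h: "pre_digraph.digraph_isomorphism (with_proj (induced G S)) h"
    and T: "with_proj (induced G T) = app_iso h (with_proj (induced G S))"
    by (auto simp: digraph_iso_def)
  let ?f = "iso_verts h"
  have "wf_digraph (with_proj (induced G S))" using h by (simp add: pre_digraph.digraph_isomorphism_def)
  then have ends: "arcs_ends (with_proj (induced G T)) = (\<lambda>(u, v). (?f u, ?f v)) ` (parcs G \<inter> S \<times> S)"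
    using wf_digraph.arcs_ends_app_iso_eq[OF _ h] T by simp
  have ver: "T = ?f ` S" using arg_cong[OF T, of verts] by simp
  have inj: "inj_on ?f S" using h by (simp add: pre_digraph.digraph_isomorphism_def)
  have "((?f u, ?f v) \<in> parcs G) = ((u, v) \<in> parcs G)" if "u \<in> S" "v \<in> S" for u v
  proof -
    have "(?f u, ?f v) \<in> parcs G \<longleftrightarrow> (?f u, ?f v) \<in> (\<lambda>(u, v). (?f u, ?f v)) ` (parcs G \<inter> S \<times> S)"
      using ends ver that by auto
    also have "\<dots> \<longleftrightarrow> (u, v) \<in> parcs G"
      using that inj by (auto dest: inj_onD)
    finally show ?thesis .
  qed
  then have "arc_iso (parcs G) ?f S T" using inj ver by (auto simp: arc_iso_def bij_betw_def)
  then show "\<exists>f. arc_iso (parcs G) f S T" by blast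
next
  assume "\<exists>f. arc_iso (parcs G) f S T"
  then obtain f where f: "arc_iso (parcs G) f S T" by blast
  let ?h = "\<lparr>iso_verts = f, iso_arcs = (\<lambda>(u, v). (f u, f v)), iso_head = snd, iso_tail = fst\<rparr>"
  have inj: "inj_on f S" and img: "f ` S = T" using arc_iso_bij[OF f] by (auto simp: bij_betw_def)
  have "wf_digraph (with_proj (induced G S))" by unfold_locales auto
  moreover have "inj_on (\<lambda>(u, v). (f u, f v)) (parcs G \<inter> S \<times> S)"
    using inj by (auto simp: inj_on_def)
  ultimately have "pre_digraph.digraph_isomorphism (with_proj (induced G S)) ?h"
    using inj by (auto simp: pre_digraph.digraph_isomorphism_def)
  moreover have "with_proj (induced G T) = app_iso ?h (with_proj (induced G S))"
  proof -
    have "(\<lambda>(u, v). (f u, f v)) ` (parcs G \<inter> S \<times> S) = parcs G \<inter> T \<times> T"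
    proof (intro equalityI subsetI)
      fix e assume "e \<in> parcs G \<inter> T \<times> T"
      then obtain u v where "e = (f u, f v)" "u \<in> S" "v \<in> S" "(f u, f v) \<in> parcs G" using img by blast
      then show "e \<in> (\<lambda>(u, v). (f u, f v)) ` (parcs G \<inter> S \<times> S)"
        using arc_iso_arcs[OF f] by (intro image_eqI[of _ _ "(u, v)"]) auto
    qed (use arc_iso_arcs[OF f] arc_iso_in[OF f] in auto)
    then show ?thesis using img by (simp add: with_proj_def app_iso_def)
  qed
  ultimately show "digraph_iso (with_proj (induced G S)) (with_proj (induced G T))"
    unfolding digraph_iso_def by blast
qed

section \<open>Blocks of a digraph as sets of vertices\<close>

definition adjacent :: "'a pair_pre_digraph \<Rightarrow> 'a \<Rightarrow> 'a \<Rightarrow> bool" where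
  "adjacent G u v \<longleftrightarrow> (u, v) \<in> parcs G \<or> (v, u) \<in> parcs G"

lemma symp_adjacent: "symp (adjacent G)"
  by (auto simp: adjacent_def symp_def)

lemma joined_cong:
  assumes "\<And>x y. x \<in> S \<Longrightarrow> y \<in> S \<Longrightarrow> adj x y = adj' x y"
  shows "joined adj S = joined adj' S"
proof -
  have "(\<lambda>x y. adj x y \<and> x \<in> S \<and> y \<in> S) = (\<lambda>x y. adj' x y \<and> x \<in> S \<and> y \<in> S)"
    using assms by auto
  then show ?thesis by (simp add: joined_def)
qed

lemma undirected_connected_iff:
  "undirected_connected (with_proj K) \<longleftrightarrow> connected_on (adjacent K) (pverts K)"
proof -
  let ?A = "parcs (mk_symmetric (with_proj K))"
  have A: "(u, v) \<in> ?A \<longleftrightarrow> adjacent K u v" for u v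
  proof
    assume "adjacent K u v"
    then show "(u, v) \<in> ?A"
      unfolding adjacent_def parcs_mk_symmetric with_proj_simps
      by (elim disjE) (rule UN_I, assumption, simp)+
  qed (auto simp: parcs_mk_symmetric adjacent_def)
  have *: "(u, v) \<in> rtrancl_on (pverts K) ?A \<longleftrightarrow> joined (adjacent K) (pverts K) u v" if u: "u \<in> pverts K" for u v
  proof
    assume "(u, v) \<in> rtrancl_on (pverts K) ?A"
    then show "joined (adjacent K) (pverts K) u v"
    proof (induct rule: rtrancl_on_induct)
      case (step y z)
      then have "joined (adjacent K) (pverts K) y z" using A by (intro joined_edge) auto
      with step(5) show ?case by (rule joined_trans)
    qed simp
  next
    assume "joined (adjacent K) (pverts K) u v"
    then show "(u, v) \<in> rtrancl_on (pverts K) ?A" unfolding joined_def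
    proof (induct rule: rtranclp_induct)
      case (step y z)
      show ?case by (rule rtrancl_on_into_rtrancl_on[OF step(3)]) (use step(2) A in auto)
    qed (use u in simp)
  qed
  show ?thesis
    unfolding undirected_connected_def connected_on_def reachable_def with_proj_simps pverts_mk_symmetric
    by (intro ball_cong refl *)
qed

text \<open>
  Deleting a vertex leaves the adjacencies among the others unchanged, so that connectivity one can
  be decided by looking at sets of vertices.
\<close>

lemma not_connectivity_one_iff_nonseparable:
  "undirected_connected (with_proj K) \<and> \<not> connectivity_one (with_proj K) \<longleftrightarrow>
   nonseparable (adjacent K) (pverts K)"
proof -
  have "undirected_connected (pre_digraph.del_vert (with_proj K) v) \<longleftrightarrow>
      connected_on (adjacent K) (pverts K - {v})" for v
  proof -
    let ?K = "\<lparr>pverts = pverts K - {v}, parcs = {a \<in> parcs K. fst a \<noteq> v \<and> snd a \<noteq> v}\<rparr>"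
    have "pre_digraph.del_vert (with_proj K) v = with_proj ?K"
      by (simp add: pre_digraph.del_vert_def with_proj_def)
    moreover have "joined (adjacent ?K) (pverts K - {v}) = joined (adjacent K) (pverts K - {v})"
      by (rule joined_cong) (auto simp: adjacent_def)
    ultimately show ?thesis by (simp add: undirected_connected_iff connected_on_def)
  qed
  then show ?thesis
    by (auto simp: connectivity_one_def nonseparable_def undirected_connected_iff)
qed

lemma nonseparable_mono:
  assumes "nonseparable adj S" "\<And>x y. adj x y \<Longrightarrow> adj' x y"
  shows "nonseparable adj' S"
proof -
  have "joined adj T x y \<Longrightarrow> joined adj' T x y" for T x y
    unfolding joined_def by (erule rtranclp_mono[THEN predicate2D, rotated]) (use assms(2) in auto)
  then show ?thesis using assms(1) by (auto simp: nonseparable_def connected_on_def)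
qed

lemma nonseparable_induced:
  "nonseparable (adjacent (induced G S)) S \<longleftrightarrow> nonseparable (adjacent G) S"
proof -
  have "joined (adjacent (induced G S)) T = joined (adjacent G) T" if "T \<subseteq> S" for T
    using that by (intro joined_cong) (auto simp: adjacent_def)
  then show ?thesis by (auto simp: nonseparable_def connected_on_def)
qed

lemma with_proj_inject [simp]: "with_proj A = with_proj B \<longleftrightarrow> A = B"
  by (auto simp: with_proj_def)

lemma (in pair_wf_digraph) subgraph_with_proj_iff:
  "subgraph H (with_proj G) \<longleftrightarrow>
    (\<exists>K. H = with_proj K \<and> pverts K \<subseteq> pverts G \<and> parcs K \<subseteq> parcs G \<inter> pverts K \<times> pverts K)"
proof
  assume H: "subgraph H (with_proj G)"
  let ?K = "\<lparr>pverts = verts H, parcs = arcs H\<rparr>"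
  have "H = with_proj ?K" using H by (auto simp: subgraph_def compatible_def with_proj_def)
  moreover have "parcs ?K \<subseteq> pverts ?K \<times> pverts ?K"
  proof -
    interpret H: wf_digraph H using H by (simp add: subgraph_def)
    have "tail H = fst" "head H = snd" using H by (auto simp: subgraph_def compatible_def)
    then show ?thesis using H.tail_in_verts H.head_in_verts by fastforce
  qed
  ultimately show "\<exists>K. H = with_proj K \<and> pverts K \<subseteq> pverts G \<and> parcs K \<subseteq> parcs G \<inter> pverts K \<times> pverts K"
    using H by (intro exI[of _ ?K]) (auto simp: subgraph_def)
next
  assume "\<exists>K. H = with_proj K \<and> pverts K \<subseteq> pverts G \<and> parcs K \<subseteq> parcs G \<inter> pverts K \<times> pverts K"
  then obtain K where K: "H = with_proj K" "pverts K \<subseteq> pverts G" "parcs K \<subseteq> parcs G \<inter> pverts K \<times> pverts K"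
    by blast
  have "wf_digraph H" using K by unfold_locales auto
  then show "subgraph H (with_proj G)"
    using K wf_digraph by (auto simp: subgraph_def compatible_def)
qed

lemma (in pair_wf_digraph) induced_pverts: "induced G (pverts G) = G"
proof -
  have "parcs G \<inter> pverts G \<times> pverts G = parcs G" using wellformed' by auto
  then show ?thesis by (simp add: induced_def)
qed

locale connectivity_one_digraph =
  fixes \<Gamma> :: "'a pair_pre_digraph"
  assumes loopfree: "pair_loopfree_digraph \<Gamma>"
    and transitive: "vertex_transitive \<Gamma>"
    and connectivity: "connectivity_one (with_proj \<Gamma>)"
begin

sublocale pair_loopfree_digraph \<Gamma> by (rule loopfree)

abbreviation "V \<equiv> pverts \<Gamma>"
abbreviation "adj \<equiv> adjacent \<Gamma>"
abbreviation "isom \<equiv> arc_iso (parcs \<Gamma>)"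

lemma V_separable: "\<not> nonseparable adj V"
  using connectivity not_connectivity_one_iff_nonseparable by blast

sublocale ug: connected_ugraph V adj
proof
  show "symp adj" by (rule symp_adjacent)
  show "\<not> adj x x" for x using pair_no_loops[of "(x, x)"] by (auto simp: adjacent_def)
  show "x \<in> V" if "adj x y" for x y using that wellformed' by (auto simp: adjacent_def)
  show conn: "connected_on adj V"
    using connectivity undirected_connected_iff by (auto simp: connectivity_one_def)
  show "\<exists>x\<in>V. \<exists>y\<in>V. x \<noteq> y"
  proof (rule ccontr)
    assume "\<not> ?thesis"
    then have "nonseparable adj V"
      using conn by (auto simp: nonseparable_def connected_on_def)
    then show False using V_separable by simp
  qed
qed

text \<open>
  Adding the missing arcs between vertices of a subgraph cannot disconnect it or any of its vertex
  deletions. Hence maximal subgraphs are induced, and maximality is a matter of vertex sets.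
\<close>

lemma blocks_eq_induced: "blocks \<Gamma> = induced \<Gamma> ` ug.block_sets"
proof (intro equalityI subsetI)
  fix B assume "B \<in> blocks \<Gamma>"
  then have max: "pre_digraph.max_subgraph (with_proj \<Gamma>)
     (\<lambda>H. undirected_connected H \<and> \<not> connectivity_one H) (with_proj B)" by (simp add: blocks_def)
  let ?S = "pverts B"
  have maxD: "K = B" if "subgraph (with_proj K) (with_proj \<Gamma>)" "nonseparable (adjacent K) (pverts K)"
    "subgraph (with_proj B) (with_proj K)" for K
  proof -
    have "undirected_connected (with_proj K) \<and> \<not> connectivity_one (with_proj K)"
      using that(2) not_connectivity_one_iff_nonseparable by blast
    then have "with_proj K = with_proj B"
      using max that(1,3) unfolding pre_digraph.max_subgraph_def by blast
    then show ?thesis by simp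
  qed
  have sub: "subgraph (with_proj B) (with_proj \<Gamma>)" and ns: "nonseparable (adjacent B) ?S"
    using max not_connectivity_one_iff_nonseparable[of B] by (auto simp: pre_digraph.max_subgraph_def)
  have B: "?S \<subseteq> V" "parcs B \<subseteq> parcs \<Gamma> \<inter> ?S \<times> ?S"
    using sub by (auto simp: subgraph_with_proj_iff)
  have nsS: "nonseparable adj ?S"
    using ns by (rule nonseparable_mono) (use B in \<open>auto simp: adjacent_def\<close>)
  have maximal: "induced \<Gamma> T = B" if T: "T \<subseteq> V" "nonseparable adj T" "?S \<subseteq> T" for T
  proof (rule maxD)
    show "subgraph (with_proj (induced \<Gamma> T)) (with_proj \<Gamma>)"
      using T by (auto simp: subgraph_with_proj_iff)
    show "nonseparable (adjacent (induced \<Gamma> T)) (pverts (induced \<Gamma> T))"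
      using T by (simp add: nonseparable_induced)
    interpret T: pair_wf_digraph "induced \<Gamma> T" by unfold_locales auto
    show "subgraph (with_proj B) (with_proj (induced \<Gamma> T))"
      using B T by (auto simp: T.subgraph_with_proj_iff)
  qed
  have "induced \<Gamma> ?S = B" using maximal B nsS by blast
  moreover have "?S \<in> ug.block_sets"
  proof -
    have "T = ?S" if "T \<subseteq> V" "nonseparable adj T" "?S \<subseteq> T" for T
      using arg_cong[OF maximal[OF that], of pverts] by simp
    then show ?thesis unfolding ug.block_sets_def using B nsS by blast
  qed
  ultimately show "B \<in> induced \<Gamma> ` ug.block_sets" by (intro image_eqI[of _ _ ?S]) simp_all
next
  fix B assume "B \<in> induced \<Gamma> ` ug.block_sets"
  then obtain S where S: "S \<in> ug.block_sets" "B = induced \<Gamma> S" by blast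
  then have SV: "S \<subseteq> V" "nonseparable adj S"
    using ug.block_sets_subset ug.block_sets_nonseparable by blast+
  have sub: "subgraph (with_proj B) (with_proj \<Gamma>)"
    using S SV by (auto simp: subgraph_with_proj_iff)
  have "H' = with_proj B" if H': "subgraph (with_proj B) H'" "subgraph H' (with_proj \<Gamma>)"
      "undirected_connected H' \<and> \<not> connectivity_one H'" for H'
  proof -
    obtain K where K: "H' = with_proj K" "pverts K \<subseteq> V" "parcs K \<subseteq> parcs \<Gamma> \<inter> pverts K \<times> pverts K"
      using H' subgraph_with_proj_iff by blast
    have "nonseparable (adjacent K) (pverts K)"
      using H' K not_connectivity_one_iff_nonseparable by blast
    then have "nonseparable adj (pverts K)"
      by (rule nonseparable_mono) (use K in \<open>auto simp: adjacent_def\<close>)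
    moreover have "S \<subseteq> pverts K" "parcs B \<subseteq> parcs K" using H' K S by (auto simp: subgraph_def)
    ultimately have "pverts K = S" using ug.block_sets_maximal S K by blast
    then have "K = B" using K S \<open>parcs B \<subseteq> parcs K\<close>
      by (intro pair_pre_digraph.equality) auto
    then show ?thesis using K by simp
  qed
  then show "B \<in> blocks \<Gamma>"
    using sub SV S not_connectivity_one_iff_nonseparable[of B]
    by (auto simp: blocks_def pre_digraph.max_subgraph_def nonseparable_induced)
qed

lemma exists_automorphism: "x \<in> V \<Longrightarrow> y \<in> V \<Longrightarrow> \<exists>g. isom g V V \<and> g x = y"
  using transitive vertex_transitive_induced[of \<Gamma> V] by (simp add: induced_pverts)

lemma V_not_block: "V \<notin> ug.block_sets"
  using V_separable ug.block_sets_nonseparable by blast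

subsection \<open>Automorphisms permute the blocks\<close>

lemma iso_adj: "isom g V V \<Longrightarrow> u \<in> V \<Longrightarrow> v \<in> V \<Longrightarrow> adj (g u) (g v) \<longleftrightarrow> adj u v"
  by (simp add: adjacent_def arc_iso_arcs)

lemma joined_automorphism:
  assumes "isom g V V" "S \<subseteq> V" "joined adj S x y"
  shows "joined adj (g ` S) (g x) (g y)"
  using assms by (intro joined_image) (auto simp: iso_adj subset_iff)

lemma nonseparable_automorphism:
  assumes g: "isom g V V" and S: "S \<subseteq> V" "nonseparable adj S"
  shows "nonseparable adj (g ` S)"
proof -
  have conn: "connected_on adj (g ` T)" if "connected_on adj T" "T \<subseteq> V" for T
    using that joined_automorphism[OF g that(2)] by (auto simp: connected_on_def)
  have "g ` S - {g v} = g ` (S - {v})" if "v \<in> S" for v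
    using that S(1) arc_iso_eq_iff[OF g] by blast
  then have "connected_on adj (g ` S - {g v})" if "v \<in> S" for v
    using that S conn[of "S - {v}"] by (auto simp: nonseparable_def)
  moreover have "connected_on adj (g ` S)" using S conn[of S] by (simp add: nonseparable_def)
  ultimately show ?thesis by (simp add: nonseparable_def)
qed

lemma automorphism_block:
  assumes g: "isom g V V" and D: "D \<in> ug.block_sets"
  shows "g ` D \<in> ug.block_sets"
proof -
  let ?h = "inv_into V g"
  have h: "isom ?h V V" by (rule arc_iso_inv[OF g])
  have DV: "D \<subseteq> V" and ns: "nonseparable adj D"
    using D ug.block_sets_subset ug.block_sets_nonseparable by auto
  have "T = g ` D" if T: "T \<subseteq> V" "nonseparable adj T" "g ` D \<subseteq> T" for T
  proof -
    have "?h ` g ` D = D" using DV arc_iso_inv_left[OF g] by (force simp: image_image)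
    then have "D \<subseteq> ?h ` T" using T(3) by blast
    moreover have "?h ` T \<subseteq> V" using T(1) arc_iso_in[OF h] by blast
    ultimately have "?h ` T = D"
      using ug.block_sets_maximal[OF D] nonseparable_automorphism[OF h T(1,2)] by blast
    moreover have "g ` ?h ` T = T" using T(1) arc_iso_inv_right[OF g] by (force simp: image_image)
    ultimately show ?thesis by simp
  qed
  moreover have "g ` D \<subseteq> V" using DV arc_iso_in[OF g] by blast
  ultimately show ?thesis
    using nonseparable_automorphism[OF g DV ns] by (simp add: ug.block_sets_def)
qed

text \<open>
  The gate is defined from the graph alone, so automorphisms respect it.
\<close>

lemma gate_automorphism:
  assumes g: "isom g V V" and D: "D \<in> ug.block_sets" and v: "v \<in> V"
  shows "ug.gate (g ` D) (g v) = g (ug.gate D v)"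
proof (rule ug.gate_eqI[OF automorphism_block[OF g D]])
  let ?c = "ug.gate D v"
  have c: "?c \<in> D" "joined adj (V - D \<union> {?c}) v ?c" using ug.gate_props[OF D v] by auto
  have DV: "D \<subseteq> V" using D ug.block_sets_subset by blast
  show "g ?c \<in> g ` D" using c by blast
  have "V - D \<union> {?c} \<subseteq> V" using DV c by auto
  then have *: "joined adj (g ` (V - D \<union> {?c})) (g v) (g ?c)"
    by (rule joined_automorphism[OF g _ c(2)])
  have "g ` (V - D \<union> {?c}) \<subseteq> V - g ` D \<union> {g ?c}"
  proof
    fix y assume "y \<in> g ` (V - D \<union> {?c})"
    then obtain u where u: "y = g u" "u \<in> V - D \<or> u = ?c" by blast
    then show "y \<in> V - g ` D \<union> {g ?c}"
      using arc_iso_in[OF g] arc_iso_eq_iff[OF g] DV by auto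
  qed
  with * show "joined adj (V - g ` D \<union> {g ?c}) (g v) (g ?c)" by (rule joined_mono)
qed

end

section \<open>Extending isomorphisms between blocks to automorphisms\<close>

context connected_ugraph
begin

definition blocks_at :: "'a \<Rightarrow> 'a set set" where
  "blocks_at x = {D \<in> block_sets. x \<in> D}"

text \<open>
  A map that is injective on every block and bijective on the blocks at every vertex is a covering
  of the tree of blocks by itself. As the tree has no cycles, \<open>block_tree_choice\<close> yields a section
  \<open>h\<close>, and unique lifting along blocks makes it a two-sided inverse.
\<close>

lemma locally_bijective_imp_bijective:
  assumes maps: "\<And>x. x \<in> V \<Longrightarrow> g x \<in> V"
    and inj: "\<And>D. D \<in> block_sets \<Longrightarrow> inj_on g D"
    and star: "\<And>x. x \<in> V \<Longrightarrow> bij_betw ((`) g) (blocks_at x) (blocks_at (g x))"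
  shows "bij_betw g V V"
proof -
  obtain z where z: "z \<in> V" using two_vertices by blast
  then obtain B where B: "B \<in> block_sets" "z \<in> B" using vertex_in_block by blast
  have gB: "g ` D \<in> block_sets" if D: "D \<in> block_sets" for D
  proof -
    obtain x where "x \<in> D" using block_has_other[OF D] by blast
    then have "(`) g ` blocks_at x = blocks_at (g x)"
      by (intro bij_betw_imp_surj_on star block_setsD[OF D])
    moreover have "D \<in> blocks_at x" using D \<open>x \<in> D\<close> by (simp add: blocks_at_def)
    ultimately have "g ` D \<in> blocks_at (g x)" by blast
    then show ?thesis by (simp add: blocks_at_def)
  qed
  \<comment> \<open>A vertex or block chooses a preimage under \<open>g\<close>; preimages of incident ones must be incident.\<close>
  define SV where "SV = (\<lambda>y. {x \<in> V. g x = y})"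
  define SB where "SB = (\<lambda>D'. {D \<in> block_sets. g ` D = D'})"
  have B': "B \<in> SB (g ` B)" using B by (simp add: SB_def)
  have down: "\<forall>D'\<in>block_sets. \<forall>y\<in>D'. \<forall>x\<in>SV y. \<exists>D\<in>SB D'. x \<in> D"
  proof (intro ballI)
    fix D' y x assume D': "D' \<in> block_sets" "y \<in> D'" and "x \<in> SV y"
    then have x: "x \<in> V" "g x = y" by (auto simp: SV_def)
    have "(`) g ` blocks_at x = blocks_at y" using star[OF x(1)] x(2) by (simp add: bij_betw_def)
    then have "D' \<in> (`) g ` blocks_at x" using D' by (simp add: blocks_at_def)
    then show "\<exists>D\<in>SB D'. x \<in> D" by (auto simp: SB_def blocks_at_def)
  qed
  have up: "\<forall>D'\<in>block_sets. \<forall>y\<in>D'. \<forall>D\<in>SB D'. \<exists>x\<in>SV y. x \<in> D"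
  proof (intro ballI)
    fix D' y D assume "y \<in> D'" "D \<in> SB D'"
    then obtain x where "x \<in> D" "D \<in> block_sets" "g x = y" by (auto simp: SB_def)
    then show "\<exists>x\<in>SV y. x \<in> D" using block_setsD by (auto simp: SV_def)
  qed
  have "\<exists>h k. k (g ` B) = B \<and> (\<forall>y\<in>V. h y \<in> SV y) \<and> (\<forall>D'\<in>block_sets. k D' \<in> SB D') \<and>
      (\<forall>D'\<in>block_sets. \<forall>y\<in>D'. h y \<in> k D')"
    by (rule block_tree_choice[where fits = "\<lambda>y D' x D. x \<in> D" and SV = SV and SB = SB, OF gB[OF B(1)] B' down up])
  then obtain h k where hk_all: "k (g ` B) = B \<and> (\<forall>y\<in>V. h y \<in> SV y) \<and> (\<forall>D'\<in>block_sets. k D' \<in> SB D') \<and>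
      (\<forall>D'\<in>block_sets. \<forall>y\<in>D'. h y \<in> k D')"
    by (elim exE)
  then have k: "k (g ` B) = B" and h: "\<And>y. y \<in> V \<Longrightarrow> h y \<in> SV y"
    and kS: "\<And>D'. D' \<in> block_sets \<Longrightarrow> k D' \<in> SB D'"
    and hk: "\<And>y D'. D' \<in> block_sets \<Longrightarrow> y \<in> D' \<Longrightarrow> h y \<in> k D'"
    by simp_all
  have hg: "h y \<in> V" "g (h y) = y" if "y \<in> V" for y using h[OF that] by (auto simp: SV_def)
  have gh_in: "h (g y) = y" if "D \<in> block_sets" "k (g ` D) = D" "y \<in> D" for D y
  proof -
    have "h (g y) \<in> k (g ` D)" by (rule hk[OF gB[OF that(1)]]) (use that(3) in blast)
    then have "h (g y) \<in> D" using that(2) by simp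
    moreover have "g (h (g y)) = g y" by (rule hg(2)[OF maps[OF block_setsD[OF that(1,3)]]])
    ultimately show ?thesis using inj_onD[OF inj[OF that(1)]] that(3) by blast
  qed
  have gh: "h (g x) = x" if "x \<in> V" for x
  proof (rule block_induct[OF z _ _ that])
    show "h (g z) = z" by (rule gh_in[OF B(1) k B(2)])
    fix D x y assume D: "D \<in> block_sets" "x \<in> D" "y \<in> D" and x: "h (g x) = x"
    let ?D = "k (g ` D)"
    have eq: "g ` ?D = g ` D" and "?D \<in> block_sets"
      using kS[OF gB[OF D(1)]] unfolding SB_def by blast+
    moreover have "x \<in> ?D" using hk[OF gB[OF D(1)] imageI[OF D(2)]] unfolding x .
    ultimately have "?D \<in> blocks_at x" "D \<in> blocks_at x" using D by (auto simp: blocks_at_def)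
    then have "?D = D"
      using inj_onD[OF bij_betw_imp_inj_on[OF star[OF block_setsD[OF D(1,2)]]] eq] by blast
    then show "h (g y) = y" by (rule gh_in[OF D(1) _ D(3)])
  qed
  show ?thesis
  proof (rule bij_betw_byWitness[where f' = h])
    show "\<forall>x\<in>V. h (g x) = x" by (intro ballI gh)
    show "\<forall>y\<in>V. g (h y) = y" by (intro ballI hg)
    show "g ` V \<subseteq> V" "h ` V \<subseteq> V" using maps hg(1) by blast+
  qed
qed

end

context connectivity_one_digraph
begin

lemma automorphism_blocks_at:
  assumes g: "isom g V V" and x: "x \<in> V"
  shows "bij_betw ((`) g) (ug.blocks_at x) (ug.blocks_at (g x))"
proof (rule bij_betw_byWitness[where f' = "(`) (inv_into V g)"])
  have h: "isom (inv_into V g) V V" by (rule arc_iso_inv[OF g])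
  show "\<forall>D\<in>ug.blocks_at x. inv_into V g ` g ` D = D"
  proof
    fix D assume "D \<in> ug.blocks_at x"
    then have "D \<subseteq> V" by (auto simp: ug.blocks_at_def dest: ug.block_setsD)
    then show "inv_into V g ` g ` D = D" using arc_iso_inv_left[OF g] by (force simp: image_image)
  qed
  show "\<forall>D\<in>ug.blocks_at (g x). g ` inv_into V g ` D = D"
  proof
    fix D assume "D \<in> ug.blocks_at (g x)"
    then have "D \<subseteq> V" by (auto simp: ug.blocks_at_def dest: ug.block_setsD)
    then show "g ` inv_into V g ` D = D" using arc_iso_inv_right[OF g] by (force simp: image_image)
  qed
  show "(`) g ` ug.blocks_at x \<subseteq> ug.blocks_at (g x)"
    using automorphism_block[OF g] by (auto simp: ug.blocks_at_def)
  show "(`) (inv_into V g) ` ug.blocks_at (g x) \<subseteq> ug.blocks_at x"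
  proof
    fix D assume "D \<in> (`) (inv_into V g) ` ug.blocks_at (g x)"
    then obtain D' where D': "D = inv_into V g ` D'" "D' \<in> ug.block_sets" "g x \<in> D'"
      by (auto simp: ug.blocks_at_def)
    have "x \<in> D" unfolding D'(1) using D'(3) arc_iso_inv_left[OF g x] by (intro image_eqI[of _ _ "g x"]) simp_all
    then show "D \<in> ug.blocks_at x" using automorphism_block[OF h] D' by (auto simp: ug.blocks_at_def)
  qed
qed

text \<open>
  All flags, that is pairs of a block and a vertex of it, look alike, as long as only the digraph
  induced on the block is considered.
\<close>

definition homogeneous_blocks :: bool where
  "homogeneous_blocks \<longleftrightarrow> (\<forall>D\<in>ug.block_sets. \<forall>D'\<in>ug.block_sets. \<forall>x\<in>D. \<forall>x'\<in>D'.
     \<exists>f. isom f D D' \<and> f x = x')"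

text \<open>
  An automorphism taking \<open>x\<close> to \<open>x'\<close> gives some bijection; a transposition then corrects the image
  of \<open>D\<close>.
\<close>

lemma bijection_of_blocks_at:
  assumes x: "x \<in> V" "x' \<in> V" and D: "D \<in> ug.blocks_at x" "D' \<in> ug.blocks_at x'"
  shows "\<exists>\<beta>. bij_betw \<beta> (ug.blocks_at x) (ug.blocks_at x') \<and> \<beta> D = D'"
proof -
  obtain h where h: "isom h V V" "h x = x'" using exists_automorphism[OF x] by blast
  let ?t = "Transposition.transpose (h ` D) D'"
  have bij: "bij_betw ((`) h) (ug.blocks_at x) (ug.blocks_at x')"
    using automorphism_blocks_at[OF h(1) x(1)] h by simp
  then have "h ` D \<in> ug.blocks_at x'" using D by (auto dest: bij_betwE)
  then have "bij_betw ?t (ug.blocks_at x') (ug.blocks_at x')" using D by simp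
  with bij have "bij_betw (?t \<circ> (`) h) (ug.blocks_at x) (ug.blocks_at x')" by (rule bij_betw_trans)
  then show ?thesis by (intro exI[of _ "?t \<circ> (`) h"]) simp
qed

text \<open>
  The extension is built by a choice along the tree of blocks: a block chooses an isomorphism to
  another block, a vertex chooses its image together with a bijection between the blocks at the
  two. By homogeneity each choice can be continued, and the map that results is locally bijective,
  hence an automorphism.
\<close>

theorem extend_block_isomorphism:
  assumes hom: "homogeneous_blocks" and B: "B \<in> ug.block_sets" "B' \<in> ug.block_sets"
    and \<phi>: "isom \<phi> B B'"
  shows "\<exists>g. isom g V V \<and> (\<forall>x\<in>B. g x = \<phi> x)"
proof -
  define SV where "SV = (\<lambda>x. {s. fst s \<in> V \<and> bij_betw (snd s) (ug.blocks_at x) (ug.blocks_at (fst s))})"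
  define SB where "SB = (\<lambda>D. {f. \<exists>D'\<in>ug.block_sets. isom f D D'})"
  define fits :: "'a \<Rightarrow> 'a set \<Rightarrow> 'a \<times> ('a set \<Rightarrow> 'a set) \<Rightarrow> ('a \<Rightarrow> 'a) \<Rightarrow> bool"
    where "fits = (\<lambda>x D s f. f x = fst s \<and> f ` D = snd s D)"
  have \<phi>B: "\<phi> \<in> SB B" using B \<phi> by (auto simp: SB_def)
  have down: "\<forall>D\<in>ug.block_sets. \<forall>x\<in>D. \<forall>s\<in>SV x. \<exists>f\<in>SB D. fits x D s f"
  proof (intro ballI)
    fix D x s assume D: "D \<in> ug.block_sets" "x \<in> D" and s: "s \<in> SV x"
    have "snd s D \<in> ug.blocks_at (fst s)"
      using s D by (auto simp: SV_def ug.blocks_at_def dest: bij_betwE)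
    then have D': "snd s D \<in> ug.block_sets" "fst s \<in> snd s D" by (auto simp: ug.blocks_at_def)
    then obtain f where f: "isom f D (snd s D)" "f x = fst s"
      using hom D unfolding homogeneous_blocks_def by blast
    then have "fits x D s f" using arc_iso_image[OF f(1)] by (simp add: fits_def)
    then show "\<exists>f\<in>SB D. fits x D s f" using f D' by (auto simp: SB_def)
  qed
  have up: "\<forall>D\<in>ug.block_sets. \<forall>x\<in>D. \<forall>f\<in>SB D. \<exists>s\<in>SV x. fits x D s f"
  proof (intro ballI)
    fix D x f assume D: "D \<in> ug.block_sets" "x \<in> D" and f: "f \<in> SB D"
    obtain D' where D': "D' \<in> ug.block_sets" "isom f D D'" using f by (auto simp: SB_def)
    then have fx: "f x \<in> D'" using arc_iso_in D by metis
    have "\<exists>\<beta>. bij_betw \<beta> (ug.blocks_at x) (ug.blocks_at (f x)) \<and> \<beta> D = D'"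
      using D D' fx ug.block_setsD by (intro bijection_of_blocks_at) (auto simp: ug.blocks_at_def)
    then obtain \<beta> where "bij_betw \<beta> (ug.blocks_at x) (ug.blocks_at (f x))" "\<beta> D = D'" by blast
    then show "\<exists>s\<in>SV x. fits x D s f"
      using arc_iso_image[OF D'(2)] ug.block_setsD[OF D'(1) fx]
      by (intro bexI[of _ "(f x, \<beta>)"]) (auto simp: SV_def fits_def)
  qed
  obtain \<sigma> \<tau> where "\<tau> B = \<phi> \<and> (\<forall>x\<in>V. \<sigma> x \<in> SV x) \<and> (\<forall>D\<in>ug.block_sets. \<tau> D \<in> SB D) \<and>
      (\<forall>D\<in>ug.block_sets. \<forall>x\<in>D. fits x D (\<sigma> x) (\<tau> D))"
    using ug.block_tree_choice[where fits = fits and SV = SV and SB = SB, OF B(1) \<phi>B down up] by (elim exE)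
  then have \<tau>B: "\<tau> B = \<phi>" and \<sigma>: "\<And>x. x \<in> V \<Longrightarrow> \<sigma> x \<in> SV x"
    and \<tau>: "\<And>D. D \<in> ug.block_sets \<Longrightarrow> \<tau> D \<in> SB D"
    and fit: "\<And>x D. D \<in> ug.block_sets \<Longrightarrow> x \<in> D \<Longrightarrow> fits x D (\<sigma> x) (\<tau> D)"
    by simp_all
  define g where "g = (\<lambda>x. fst (\<sigma> x))"
  have g_block: "g x = \<tau> D x" if "D \<in> ug.block_sets" "x \<in> D" for x D
    using fit[OF that] by (simp add: g_def fits_def)
  have isoD: "isom g D (g ` D)" if D: "D \<in> ug.block_sets" for D
  proof -
    obtain D' where "isom (\<tau> D) D D'" using \<tau>[OF D] by (auto simp: SB_def)
    then have "isom g D D'" by (rule arc_iso_cong) (rule g_block[OF D])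
    then show ?thesis using arc_iso_image by metis
  qed
  have star: "bij_betw ((`) g) (ug.blocks_at x) (ug.blocks_at (g x))" if x: "x \<in> V" for x
  proof -
    have "g ` D = snd (\<sigma> x) D" if "D \<in> ug.blocks_at x" for D
    proof -
      have D: "D \<in> ug.block_sets" "x \<in> D" using that by (auto simp: ug.blocks_at_def)
      have "g ` D = \<tau> D ` D" using g_block[OF D(1)] by (rule image_cong[OF refl])
      then show ?thesis using fit[OF D] by (simp add: fits_def)
    qed
    then have "bij_betw ((`) g) (ug.blocks_at x) (ug.blocks_at (g x)) =
        bij_betw (snd (\<sigma> x)) (ug.blocks_at x) (ug.blocks_at (g x))" by (rule bij_betw_cong)
    then show ?thesis using \<sigma>[OF x] by (simp add: SV_def g_def)
  qed
  have gV: "g x \<in> V" if "x \<in> V" for x using \<sigma>[OF that] by (simp add: SV_def g_def)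
  have bij: "bij_betw g V V"
    by (rule ug.locally_bijective_imp_bijective[OF gV arc_iso_bij[OF isoD, THEN bij_betw_imp_inj_on] star])
  have "(g u, g v) \<in> parcs \<Gamma> \<longleftrightarrow> (u, v) \<in> parcs \<Gamma>" if u: "u \<in> V" and v: "v \<in> V" for u v
  proof
    assume "(g u, g v) \<in> parcs \<Gamma>"
    then have "adj (g u) (g v)" by (simp add: adjacent_def)
    then obtain D' where D': "D' \<in> ug.blocks_at (g u)" "g v \<in> D'"
      using ug.edge_in_block by (auto simp: ug.blocks_at_def)
    moreover have "(`) g ` ug.blocks_at u = ug.blocks_at (g u)"
      using star[OF u] by (simp add: bij_betw_def)
    ultimately have "D' \<in> (`) g ` ug.blocks_at u" by simp
    then obtain D where D: "D \<in> ug.block_sets" "u \<in> D" "D' = g ` D"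
      by (auto simp: ug.blocks_at_def)
    then obtain w where w: "w \<in> D" "g v = g w" using D' by blast
    then have "w = v"
      using inj_onD[OF bij_betw_imp_inj_on[OF bij]] v ug.block_setsD[OF D(1)] by metis
    then show "(u, v) \<in> parcs \<Gamma>" using arc_iso_arcs[OF isoD[OF D(1)]] D w \<open>(g u, g v) \<in> parcs \<Gamma>\<close> by blast
  next
    assume uv: "(u, v) \<in> parcs \<Gamma>"
    then obtain D where "D \<in> ug.block_sets" "u \<in> D" "v \<in> D"
      using ug.edge_in_block[of u v] by (auto simp: adjacent_def)
    then show "(g u, g v) \<in> parcs \<Gamma>" using arc_iso_arcs[OF isoD] uv by blast
  qed
  then have "isom g V V" using bij by (auto simp: arc_iso_def)
  moreover have "\<forall>x\<in>B. g x = \<phi> x" using g_block[OF B(1)] \<tau>B by simp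
  ultimately show ?thesis by blast
qed

text \<open>
  The vertices with gate \<open>z\<close> are attached to the rest of the digraph only at \<open>z\<close>. As \<open>z\<close> is fixed,
  an extension of \<open>\<alpha>\<close> maps this branch to itself and may be replaced by the identity on it.
\<close>

lemma extend_block_automorphism_fixing_branch:
  assumes hom: "homogeneous_blocks" and B: "B \<in> ug.block_sets"
    and \<alpha>: "isom \<alpha> B B" and z: "z \<in> B" "\<alpha> z = z"
  shows "\<exists>g. isom g V V \<and> (\<forall>x\<in>B. g x = \<alpha> x) \<and> (\<forall>v\<in>V. ug.gate B v = z \<longrightarrow> g v = v)"
proof -
  obtain h where "isom h V V \<and> (\<forall>x\<in>B. h x = \<alpha> x)"
    using extend_block_isomorphism[OF hom B B \<alpha>] by (elim exE)
  then have h: "isom h V V" and h\<alpha>: "\<And>x. x \<in> B \<Longrightarrow> h x = \<alpha> x" by simp_all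
  have hB: "h ` B = B" using image_cong[OF refl h\<alpha>] arc_iso_image[OF \<alpha>] by (rule trans)
  have branch: "ug.gate B (h v) = z \<longleftrightarrow> ug.gate B v = z" if "v \<in> V" for v
  proof -
    have c: "ug.gate B v \<in> B" by (rule ug.gate_in[OF B that])
    have "ug.gate B (h v) = \<alpha> (ug.gate B v)" using gate_automorphism[OF h B that] hB h\<alpha>[OF c] by simp
    then show ?thesis using arc_iso_eq_iff[OF \<alpha> c z(1)] z(2) by simp
  qed
  have edge: "u = z" if uw: "adj u w" "ug.gate B u = z" "ug.gate B w \<noteq> z" for u w
  proof -
    obtain C where C: "C \<in> ug.block_sets" "u \<in> C" "w \<in> C" using ug.edge_in_block[OF uw(1)] by blast
    have "C = B"
    proof (rule ccontr)
      assume "C \<noteq> B"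
      then have "ug.gate B u = ug.gate B w"
        by (intro ug.gate_constant_on_other_block[OF B C(1) _ C(2,3)]) simp
      then show False using uw(2,3) by simp
    qed
    then show ?thesis using ug.gate_self[OF B] C uw by simp
  qed
  define g where "g = (\<lambda>v. if ug.gate B v = z then v else h v)"
  have g_in: "g v = v" if "ug.gate B v = z" for v using that by (simp add: g_def)
  have g_out: "g v = h v" if "ug.gate B v \<noteq> z" for v using that by (simp add: g_def)
  have g_gate: "ug.gate B (g v) = z \<longleftrightarrow> ug.gate B v = z" if "v \<in> V" for v
    by (cases "ug.gate B v = z") (simp_all add: g_in g_out branch[OF that])
  have "inj_on g V"
  proof (rule inj_onI)
    fix u v assume u: "u \<in> V" and v: "v \<in> V" and eq: "g u = g v"
    show "u = v"
    proof (cases "ug.gate B u = z")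
      case True
      then have "ug.gate B v = z" using g_gate[OF u] g_gate[OF v] eq by simp
      then show ?thesis using eq g_in[OF True] g_in[of v] by simp
    next
      case False
      then have "ug.gate B v \<noteq> z" using g_gate[OF u] g_gate[OF v] eq by simp
      then show ?thesis using eq g_out[OF False] g_out[of v] arc_iso_eq_iff[OF h u v] by simp
    qed
  qed
  moreover have "g ` V = V"
  proof (intro equalityI subsetI)
    fix y assume "y \<in> g ` V"
    then obtain x where "x \<in> V" "y = g x" by (rule imageE)
    then show "y \<in> V" using arc_iso_in[OF h, of x] by (simp add: g_def)
  next
    fix y assume y: "y \<in> V"
    show "y \<in> g ` V"
    proof (cases "ug.gate B y = z")
      case True
      then show ?thesis using g_in[of y] y by (metis imageI)
    next
      case False
      obtain x where x: "y = h x" "x \<in> V" using y arc_iso_image[OF h] by (metis imageE)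
      then have "g x = y" using g_out[of x] branch[OF x(2)] False by simp
      then show ?thesis using x(2) by (rule rev_image_eqI[rotated, OF sym])
    qed
  qed
  ultimately have bij: "bij_betw g V V" by (simp add: bij_betw_def)
  have arcs: "(g u, g v) \<in> parcs \<Gamma> \<longleftrightarrow> (u, v) \<in> parcs \<Gamma>" if uv: "u \<in> V" "v \<in> V" for u v
  proof -
    have mixed: "u = z \<and> h u = u \<or> \<not> adj u (h w) \<and> \<not> adj u w \<and> \<not> adj (h w) u \<and> \<not> adj w u"
      if "u \<in> V" "w \<in> V" "ug.gate B u = z" "ug.gate B w \<noteq> z" for u w
    proof (cases "u = z")
      case True
      then show ?thesis using h\<alpha>[OF z(1)] z(2) by simp
    next
      case False
      have "\<not> adj u w" using edge[of u w] that(3,4) False by blast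
      moreover have "\<not> adj u (h w)" using edge[of u "h w"] branch[OF that(2)] that(3,4) False by blast
      ultimately show ?thesis using ug.adj_sym[of w u] ug.adj_sym[of "h w" u] by blast
    qed
    show ?thesis
    proof (cases "ug.gate B u = z"; cases "ug.gate B v = z")
      assume "ug.gate B u = z" "ug.gate B v \<noteq> z"
      moreover from this have "g u = u" "g v = h v" by (simp_all add: g_def)
      ultimately show ?thesis
        using mixed[OF uv] arc_iso_arcs[OF h uv] unfolding adjacent_def by metis
    next
      assume "ug.gate B u \<noteq> z" "ug.gate B v = z"
      moreover from this have "g u = h u" "g v = v" by (simp_all add: g_def)
      ultimately show ?thesis
        using mixed[OF uv(2,1)] arc_iso_arcs[OF h uv] unfolding adjacent_def by metis
    qed (use arc_iso_arcs[OF h uv] in \<open>simp_all add: g_def\<close>)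
  qed
  have "isom g V V" using bij arcs by (auto simp: arc_iso_def)
  moreover have "g x = \<alpha> x" if "x \<in> B" for x
    using ug.gate_self[OF B that] h\<alpha>[OF that] z by (auto simp: g_def)
  moreover have "g v = v" if "ug.gate B v = z" for v using that by (simp add: g_def)
  ultimately show ?thesis by (intro exI[of _ g] conjI ballI impI)
qed

section \<open>Blocks of a primitive digraph\<close>

abbreviation "aut g \<equiv> isom g V V"

lemma aut_quotient:
  assumes g: "aut g" and h: "aut h"
  shows "\<exists>f. aut f \<and> (\<forall>v\<in>V. g (f v) = h v) \<and> (\<forall>S T. S \<subseteq> V \<longrightarrow> T \<subseteq> V \<longrightarrow> h ` S = g ` T \<longrightarrow> f ` S = T)"
proof (intro exI[of _ "\<lambda>v. inv_into V g (h v)"] conjI ballI allI impI)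
  show "aut (\<lambda>v. inv_into V g (h v))" by (rule arc_iso_comp[OF h arc_iso_inv[OF g]])
  show "g (inv_into V g (h v)) = h v" if "v \<in> V" for v
    by (rule arc_iso_inv_right[OF g arc_iso_in[OF h that]])
  fix S T assume ST: "S \<subseteq> V" "T \<subseteq> V" "h ` S = g ` T"
  have "(\<lambda>v. inv_into V g (h v)) ` S = inv_into V g ` g ` T"
    by (simp add: image_image flip: ST(3))
  also have "\<dots> = (\<lambda>v. v) ` T"
    unfolding image_image by (rule image_cong[OF refl arc_iso_inv_left[OF g]]) (use ST(2) in blast)
  finally show "(\<lambda>v. inv_into V g (h v)) ` S = T" by simp
qed

lemma aut_isom_block: "aut g \<Longrightarrow> D \<in> ug.block_sets \<Longrightarrow> isom g D (g ` D)"
  by (rule arc_iso_subset[OF _ ug.block_sets_subset])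

lemma primitive_relation_trivial:
  assumes "primitive_graph \<Gamma>" "invariant_equiv (parcs \<Gamma>) V r"
  shows "r = Id_on V \<or> r = V \<times> V"
  using assms primitive_graph_induced[of \<Gamma> V] by (simp add: induced_pverts)

text \<open>
  The relations generate an invariant equivalence relation \<open>S\<close> on all vertices. Following gates in
  \<open>D\<close> along a chain of related vertices shows that \<open>S\<close> relates no more vertices of \<open>D\<close> than \<open>\<rho> D\<close>
  does. By primitivity \<open>S\<close> is trivial, and so are all \<open>\<rho> D\<close>, in the same way.
\<close>

lemma invariant_block_relations_trivial:
  assumes prim: "primitive_graph \<Gamma>"
    and equiv: "\<And>D. D \<in> ug.block_sets \<Longrightarrow> equiv D (\<rho> D)"
    and inv: "\<And>D g x y. D \<in> ug.block_sets \<Longrightarrow> aut g \<Longrightarrow> (x, y) \<in> \<rho> D \<Longrightarrow> (g x, g y) \<in> \<rho> (g ` D)"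
  shows "(\<forall>D\<in>ug.block_sets. \<rho> D = Id_on D) \<or> (\<forall>D\<in>ug.block_sets. \<rho> D = D \<times> D)"
proof -
  define R where "R = (\<Union>D\<in>ug.block_sets. \<rho> D)"
  define S where "S = R\<^sup>* \<inter> V \<times> V"
  have sub: "\<rho> D \<subseteq> D \<times> D" and refl: "refl_on D (\<rho> D)" and sym: "sym (\<rho> D)" and trans: "trans (\<rho> D)"
    if "D \<in> ug.block_sets" for D
    using equiv[OF that] by (simp_all add: equiv_def)
  have "(v, u) \<in> R" if "(u, v) \<in> R" for u v
    using that symD[OF sym] unfolding R_def by blast
  then have "sym (R\<^sup>*)" by (intro sym_rtrancl symI)
  then have "sym S" unfolding S_def sym_def by blast
  moreover have "trans S"
  proof (rule transI)
    fix x y z assume "(x, y) \<in> S" "(y, z) \<in> S"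
    then have "(x, z) \<in> R\<^sup>*" "x \<in> V" "z \<in> V" using rtrancl_trans[of x y R z] by (auto simp: S_def)
    then show "(x, z) \<in> S" by (simp add: S_def)
  qed
  moreover have "refl_on V S" by (auto simp: S_def refl_on_def)
  moreover have "S \<subseteq> V \<times> V" by (auto simp: S_def)
  ultimately have "equiv V S" by (intro equivI)
  moreover have "(g x, g y) \<in> S" if g: "aut g" and xy: "(x, y) \<in> S" for g x y
  proof -
    have "(x, y) \<in> R\<^sup>*" using xy by (simp add: S_def)
    then have "(g x, g y) \<in> R\<^sup>*"
    proof induct
      case (step u v)
      then obtain D where D: "D \<in> ug.block_sets" "(u, v) \<in> \<rho> D" by (auto simp: R_def)
      have "(g u, g v) \<in> R"
        unfolding R_def
        by (rule UN_I[of "g ` D"]) (rule automorphism_block[OF g D(1)], rule inv[OF D(1) g D(2)])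
      with step(3) show ?case by (rule rtrancl_into_rtrancl)
    qed simp
    then show ?thesis using xy arc_iso_in[OF g] by (simp add: S_def)
  qed
  ultimately have "invariant_equiv (parcs \<Gamma>) V S" by (simp add: invariant_equiv_def)
  then have S: "S = Id_on V \<or> S = V \<times> V" by (rule primitive_relation_trivial[OF prim])
  \<comment> \<open>A step inside a block other than \<open>D\<close> does not move the gate.\<close>
  have gates: "(ug.gate D u, ug.gate D v) \<in> \<rho> D" if D: "D \<in> ug.block_sets" and u: "u \<in> V" and uv: "(u, v) \<in> R\<^sup>*" for D u v
    using uv
  proof induct
    case base
    show ?case using refl[OF D] ug.gate_in[OF D u] by (simp add: refl_on_def)
  next
    case (step v w)
    then obtain E where E: "E \<in> ug.block_sets" "(v, w) \<in> \<rho> E" by (auto simp: R_def)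
    then have vw: "v \<in> E" "w \<in> E" using sub by blast+
    show ?case
    proof (cases "D = E")
      case True
      then have "(ug.gate D v, ug.gate D w) \<in> \<rho> D" using E vw ug.gate_self by simp
      with step(3) show ?thesis by (rule transD[OF trans[OF D]])
    next
      case False
      then show ?thesis using step(3) ug.gate_constant_on_other_block[OF D E(1) False vw] by simp
    qed
  qed
  have restrict: "(x, y) \<in> \<rho> D" if "D \<in> ug.block_sets" "x \<in> D" "y \<in> D" "(x, y) \<in> S" for D x y
  proof -
    have "(x, y) \<in> R\<^sup>*" using that(4) by (simp add: S_def)
    then have "(ug.gate D x, ug.gate D y) \<in> \<rho> D"
      by (rule gates[OF that(1) ug.block_setsD[OF that(1,2)]])
    then show ?thesis by (simp add: ug.gate_self[OF that(1)] that(2,3))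
  qed
  from S show ?thesis
  proof
    assume Id: "S = Id_on V"
    have "\<rho> D = Id_on D" if D: "D \<in> ug.block_sets" for D
    proof (intro equalityI subrelI)
      fix x y assume xy: "(x, y) \<in> \<rho> D"
      then have "(x, y) \<in> R" using D by (auto simp: R_def)
      moreover have "x \<in> D" "y \<in> D" using sub[OF D] xy by auto
      ultimately have "(x, y) \<in> S" using ug.block_setsD[OF D] by (auto simp: S_def)
      then show "(x, y) \<in> Id_on D" using Id \<open>x \<in> D\<close> by auto
    qed (use refl[OF D] in \<open>auto simp: refl_on_def\<close>)
    then show ?thesis by blast
  next
    assume all: "S = V \<times> V"
    have "\<rho> D = D \<times> D" if D: "D \<in> ug.block_sets" for D
    proof (intro equalityI sub[OF D] subrelI)
      fix x y assume "(x, y) \<in> D \<times> D"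
      then show "(x, y) \<in> \<rho> D" using all ug.block_setsD[OF D] by (intro restrict[OF D]) auto
    qed
    then show ?thesis by blast
  qed
qed

text \<open>
  Read \<open>\<Phi> D\<close> as the admissible ways of folding the block \<open>D\<close> onto \<open>T\<close>, each determined by its value
  at one vertex. Along the tree of blocks, foldings of the blocks combine to a map \<open>r\<close> from all
  vertices to \<open>T\<close>. Following \<open>r\<close> after an automorphism is again such a map, so it differs from \<open>r\<close>
  by a symmetry of \<open>T\<close> only, and equality under \<open>r\<close> is an invariant equivalence relation. It is not
  universal as \<open>T\<close> has two elements, and not equality as a single block already covers \<open>T\<close>.
\<close>

lemma no_invariant_folding:
  fixes T :: "'t set"
  assumes prim: "primitive_graph \<Gamma>"
    and ex: "\<And>D x t. D \<in> ug.block_sets \<Longrightarrow> x \<in> D \<Longrightarrow> t \<in> T \<Longrightarrow> \<exists>\<phi>\<in>\<Phi> D. \<phi> x = t"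
    and unique: "\<And>D \<phi> \<psi> x y. D \<in> ug.block_sets \<Longrightarrow> \<phi> \<in> \<Phi> D \<Longrightarrow> \<psi> \<in> \<Phi> D \<Longrightarrow> x \<in> D \<Longrightarrow> y \<in> D \<Longrightarrow>
      \<phi> x = \<psi> x \<Longrightarrow> \<phi> y = \<psi> y"
    and inv: "\<And>D g \<phi>. D \<in> ug.block_sets \<Longrightarrow> aut g \<Longrightarrow> \<phi> \<in> \<Phi> (g ` D) \<Longrightarrow> (\<lambda>x. \<phi> (g x)) \<in> \<Phi> D"
    and sym: "\<And>t t'. t \<in> T \<Longrightarrow> t' \<in> T \<Longrightarrow>
      \<exists>a. a t = t' \<and> (\<forall>D\<in>ug.block_sets. \<forall>\<phi>\<in>\<Phi> D. (\<lambda>x. a (\<phi> x)) \<in> \<Phi> D)"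
    and onto: "\<And>D \<phi>. D \<in> ug.block_sets \<Longrightarrow> \<phi> \<in> \<Phi> D \<Longrightarrow> \<phi> ` D = T"
    and two: "t1 \<in> T" "t2 \<in> T" "t1 \<noteq> t2"
  shows False
proof -
  obtain z where z: "z \<in> V" using ug.two_vertices by blast
  then obtain B where B: "B \<in> ug.block_sets" "z \<in> B" using ug.vertex_in_block by blast
  obtain \<phi>0 where \<phi>0: "\<phi>0 \<in> \<Phi> B" using ex[OF B two(1)] by blast
  have down: "\<forall>D\<in>ug.block_sets. \<forall>x\<in>D. \<forall>t\<in>T. \<exists>\<phi>\<in>\<Phi> D. \<phi> x = t" by (intro ballI ex)
  have up: "\<forall>D\<in>ug.block_sets. \<forall>x\<in>D. \<forall>\<phi>\<in>\<Phi> D. \<exists>t\<in>T. \<phi> x = t"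
  proof (intro ballI)
    fix D x \<phi> assume "D \<in> ug.block_sets" "x \<in> D" "\<phi> \<in> \<Phi> D"
    then have "\<phi> x \<in> T" using onto[of D \<phi>] imageI[of x D \<phi>] by simp
    then show "\<exists>t\<in>T. \<phi> x = t" by blast
  qed
  have "\<exists>r \<tau>. \<tau> B = \<phi>0 \<and> (\<forall>x\<in>V. r x \<in> T) \<and> (\<forall>D\<in>ug.block_sets. \<tau> D \<in> \<Phi> D) \<and>
      (\<forall>D\<in>ug.block_sets. \<forall>x\<in>D. \<tau> D x = r x)"
    by (rule ug.block_tree_choice[where fits = "\<lambda>x D t \<phi>. \<phi> x = t" and SV = "\<lambda>_. T" and SB = \<Phi>, OF B(1) \<phi>0 down up])
  then obtain r \<tau> where "\<tau> B = \<phi>0 \<and> (\<forall>x\<in>V. r x \<in> T) \<and> (\<forall>D\<in>ug.block_sets. \<tau> D \<in> \<Phi> D) \<and>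
      (\<forall>D\<in>ug.block_sets. \<forall>x\<in>D. \<tau> D x = r x)" by (elim exE)
  then have rT: "\<And>x. x \<in> V \<Longrightarrow> r x \<in> T" and \<tau>: "\<And>D. D \<in> ug.block_sets \<Longrightarrow> \<tau> D \<in> \<Phi> D"
    and r\<tau>: "\<And>D x. D \<in> ug.block_sets \<Longrightarrow> x \<in> D \<Longrightarrow> \<tau> D x = r x" by simp_all
  define K where "K = {(x, y). x \<in> V \<and> y \<in> V \<and> r x = r y}"
  have "equiv V K" by (auto simp: K_def equiv_def refl_on_def sym_def trans_def)
  moreover have "(g x, g y) \<in> K" if g: "aut g" and xy: "(x, y) \<in> K" for g x y
  proof -
    obtain a where a: "a (r z) = r (g z) \<and> (\<forall>D\<in>ug.block_sets. \<forall>\<phi>\<in>\<Phi> D. (\<lambda>x. a (\<phi> x)) \<in> \<Phi> D)"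
      using sym[OF rT[OF z] rT[OF arc_iso_in[OF g z]]] by (elim exE)
    \<comment> \<open>Both sides fold every block, so agreement at \<open>z\<close> spreads to all vertices.\<close>
    have r_aut: "r (g v) = a (r v)" if v: "v \<in> V" for v
    proof (rule ug.block_induct[OF z _ _ v])
      show "r (g z) = a (r z)" using a by simp
      fix D x y assume D: "D \<in> ug.block_sets" "x \<in> D" "y \<in> D" and x: "r (g x) = a (r x)"
      have gD: "g ` D \<in> ug.block_sets" by (rule automorphism_block[OF g D(1)])
      have val: "\<tau> (g ` D) (g w) = r (g w)" "a (\<tau> D w) = a (r w)" if "w \<in> D" for w
        using r\<tau>[OF gD imageI[OF that]] r\<tau>[OF D(1) that] by simp_all
      have "\<tau> (g ` D) (g y) = a (\<tau> D y)"
      proof (rule unique[OF D(1) inv[OF D(1) g \<tau>[OF gD]] _ D(2,3)])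
        show "(\<lambda>x. a (\<tau> D x)) \<in> \<Phi> D" using a \<tau>[OF D(1)] D(1) by blast
        show "\<tau> (g ` D) (g x) = a (\<tau> D x)" using val[OF D(2)] x by simp
      qed
      then show "r (g y) = a (r y)" using val[OF D(3)] by simp
    qed
    show ?thesis using xy r_aut[of x] r_aut[of y] arc_iso_in[OF g] by (auto simp: K_def)
  qed
  ultimately have "invariant_equiv (parcs \<Gamma>) V K" by (simp add: invariant_equiv_def)
  then consider "K = Id_on V" | "K = V \<times> V" using primitive_relation_trivial[OF prim] by blast
  then show False
  proof cases
    case 1
    have "B \<subseteq> V" "B \<noteq> V" using B V_not_block ug.block_sets_subset by auto
    then obtain v where v: "v \<in> V" "v \<notin> B" by blast
    then have "r v \<in> \<tau> B ` B" using rT[OF v(1)] onto[OF B(1) \<tau>[OF B(1)]] by simp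
    then obtain w where w: "w \<in> B" "r v = \<tau> B w" by blast
    then have "(w, v) \<in> K" using r\<tau>[OF B(1) w(1)] v ug.block_setsD[OF B(1)] by (simp add: K_def)
    then show False using 1 w v by auto
  next
    case 2
    have "t1 \<in> \<tau> B ` B" "t2 \<in> \<tau> B ` B" using two onto[OF B(1) \<tau>[OF B(1)]] by simp_all
    then obtain w1 w2 where w: "w1 \<in> B" "t1 = \<tau> B w1" "w2 \<in> B" "t2 = \<tau> B w2" by blast
    then have "(w1, w2) \<in> K" using 2 ug.block_setsD[OF B(1)] by simp
    then show False using w r\<tau>[OF B(1)] two by (simp add: K_def)
  qed
qed

text \<open>
  An invariant division of the blocks into two parts, without a preference for either part, is a
  folding onto a set with two elements: the parity of the number of changes between the parts on
  the way from a base vertex is well defined, as the blocks form a tree. Thus \<open>\<kappa> D\<close> matters only up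
  to complement.
\<close>

lemma no_invariant_bipartition:
  assumes prim: "primitive_graph \<Gamma>"
    and split: "\<And>D. D \<in> ug.block_sets \<Longrightarrow> (\<exists>x\<in>D. \<kappa> D x) \<and> (\<exists>x\<in>D. \<not> \<kappa> D x)"
    and inv: "\<And>D g x y. D \<in> ug.block_sets \<Longrightarrow> aut g \<Longrightarrow> x \<in> D \<Longrightarrow> y \<in> D \<Longrightarrow>
      (\<kappa> (g ` D) (g x) = \<kappa> (g ` D) (g y)) \<longleftrightarrow> (\<kappa> D x = \<kappa> D y)"
  shows False
proof -
  define \<Phi> :: "'a set \<Rightarrow> ('a \<Rightarrow> bool) set" where "\<Phi> = (\<lambda>D. {h. \<forall>x\<in>D. \<forall>y\<in>D. h x = h y \<longleftrightarrow> \<kappa> D x = \<kappa> D y})"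
  show False
  proof (rule no_invariant_folding[OF prim, where T = UNIV and \<Phi> = \<Phi> and ?t1.0 = True and ?t2.0 = False])
    fix D x and t :: bool assume D: "D \<in> ug.block_sets" "x \<in> D"
    show "\<exists>\<phi>\<in>\<Phi> D. \<phi> x = t"
    proof (rule bexI[of _ "\<lambda>y. (\<kappa> D y = \<kappa> D x) = t"])
      show "(\<lambda>y. (\<kappa> D y = \<kappa> D x) = t) \<in> \<Phi> D"
        unfolding \<Phi>_def by (intro CollectI ballI) blast
    qed simp
  next
    fix D \<phi> \<psi> x y assume "D \<in> ug.block_sets" "\<phi> \<in> \<Phi> D" "\<psi> \<in> \<Phi> D" "x \<in> D" "y \<in> D" and eq: "\<phi> x = \<psi> x"
    then have "(\<phi> x = \<phi> y) = (\<kappa> D x = \<kappa> D y)" "(\<psi> x = \<psi> y) = (\<kappa> D x = \<kappa> D y)"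
      unfolding \<Phi>_def by blast+
    then show "\<phi> y = \<psi> y" using eq by auto
  next
    fix D g \<phi> assume D: "D \<in> ug.block_sets" "aut g" "\<phi> \<in> \<Phi> (g ` D)"
    show "(\<lambda>x. \<phi> (g x)) \<in> \<Phi> D"
      unfolding \<Phi>_def
    proof (intro CollectI ballI)
      fix x y assume xy: "x \<in> D" "y \<in> D"
      have *: "\<forall>u\<in>g ` D. \<forall>v\<in>g ` D. \<phi> u = \<phi> v \<longleftrightarrow> \<kappa> (g ` D) u = \<kappa> (g ` D) v"
        using D(3) by (simp add: \<Phi>_def)
      have "\<phi> (g x) = \<phi> (g y) \<longleftrightarrow> \<kappa> (g ` D) (g x) = \<kappa> (g ` D) (g y)"
        by (rule *[rule_format, OF imageI[OF xy(1)] imageI[OF xy(2)]])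
      also note inv[OF D(1,2) xy]
      finally show "\<phi> (g x) = \<phi> (g y) \<longleftrightarrow> \<kappa> D x = \<kappa> D y" .
    qed
  next
    fix t t' :: bool
    show "\<exists>a. a t = t' \<and> (\<forall>D\<in>ug.block_sets. \<forall>\<phi>\<in>\<Phi> D. (\<lambda>x. a (\<phi> x)) \<in> \<Phi> D)"
    proof (intro exI[of _ "\<lambda>b. b = (t = t')"] conjI ballI)
      show "(t = (t = t')) = t'" by blast
      fix D \<phi> assume \<phi>: "\<phi> \<in> \<Phi> D"
      show "(\<lambda>x. \<phi> x = (t = t')) \<in> \<Phi> D"
        unfolding \<Phi>_def
      proof (intro CollectI ballI)
        fix x y assume "x \<in> D" "y \<in> D"
        then have "(\<phi> x = \<phi> y) = (\<kappa> D x = \<kappa> D y)" using \<phi> unfolding \<Phi>_def by blast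
        then show "((\<phi> x = (t = t')) = (\<phi> y = (t = t'))) = (\<kappa> D x = \<kappa> D y)" by blast
      qed
    qed
  next
    fix D \<phi> assume D: "D \<in> ug.block_sets" "\<phi> \<in> \<Phi> D"
    obtain x y where "x \<in> D" "y \<in> D" "\<kappa> D x" "\<not> \<kappa> D y" using split[OF D(1)] by blast
    then have neq: "\<phi> x \<noteq> \<phi> y" using D(2) unfolding \<Phi>_def by blast
    have "b \<in> \<phi> ` D" for b
    proof -
      have "b = \<phi> x \<or> b = \<phi> y" using neq by blast
      then show ?thesis using \<open>x \<in> D\<close> \<open>y \<in> D\<close> by (elim disjE) simp_all
    qed
    then show "\<phi> ` D = UNIV" by blast
  qed simp_all
qed

lemma block_two: "D \<in> ug.block_sets \<Longrightarrow> \<exists>x\<in>D. \<exists>y\<in>D. x \<noteq> y"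
  by (metis ug.block_has_other)

text \<open>
  Apply \<open>invariant_block_relations_trivial\<close> to the universal relation on the blocks in the orbit
  of \<open>D\<close> and equality on all others.
\<close>

lemma primitive_transitive_on_blocks:
  assumes prim: "primitive_graph \<Gamma>" and D: "D \<in> ug.block_sets" and D': "D' \<in> ug.block_sets"
  shows "\<exists>g. aut g \<and> g ` D = D'"
proof -
  define Orb where "Orb = {E. \<exists>g. aut g \<and> g ` D = E}"
  define \<rho> where "\<rho> = (\<lambda>E. if E \<in> Orb then E \<times> E else Id_on E)"
  have Orb: "g ` E \<in> Orb" if E: "E \<in> Orb" and g: "aut g" for E g
  proof -
    obtain h where h: "aut h" "h ` D = E" using E unfolding Orb_def by blast
    have "(\<lambda>v. g (h v)) ` D = g ` E" unfolding h(2)[symmetric] by (simp add: image_image)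
    then show ?thesis using arc_iso_comp[OF h(1) g] unfolding Orb_def by blast
  qed
  have "(\<lambda>v. v) ` D = D" by simp
  then have "D \<in> Orb" using arc_iso_id[of "parcs \<Gamma>" V] unfolding Orb_def by blast
  have "(\<forall>E\<in>ug.block_sets. \<rho> E = Id_on E) \<or> (\<forall>E\<in>ug.block_sets. \<rho> E = E \<times> E)"
  proof (rule invariant_block_relations_trivial[OF prim])
    show "equiv E (\<rho> E)" for E
      by (auto simp: \<rho>_def equiv_def refl_on_def sym_def trans_def)
    fix E g x y assume g: "aut g" and xy: "(x, y) \<in> \<rho> E"
    show "(g x, g y) \<in> \<rho> (g ` E)"
    proof (cases "E \<in> Orb")
      case True
      then show ?thesis using xy Orb[OF True g] by (simp add: \<rho>_def)
    next
      case False
      then show ?thesis using xy by (auto simp: \<rho>_def)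
    qed
  qed
  moreover have "\<rho> D \<noteq> Id_on D" using \<open>D \<in> Orb\<close> block_two[OF D] by (auto simp: \<rho>_def)
  ultimately have "\<rho> D' = D' \<times> D'" using D D' by blast
  moreover have "Id_on D' \<noteq> D' \<times> D'" using block_two[OF D'] by auto
  ultimately have "D' \<in> Orb" by (auto simp: \<rho>_def split: if_splits)
  then show ?thesis by (simp add: Orb_def)
qed

text \<open>
  Otherwise each block would be divided into the images of \<open>x\<close> under the automorphisms taking \<open>B\<close>
  to it and the rest, with the images of \<open>y\<close> in the second part.
\<close>

lemma primitive_transitive_within_block:
  assumes prim: "primitive_graph \<Gamma>" and B: "B \<in> ug.block_sets" and xy: "x \<in> B" "y \<in> B"
  shows "\<exists>g. aut g \<and> g ` B = B \<and> g x = y"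
proof (rule ccontr)
  assume neg: "\<not> ?thesis"
  define \<kappa> where "\<kappa> = (\<lambda>E v. \<exists>g. aut g \<and> g ` B = E \<and> g x = v)"
  have BV: "B \<subseteq> V" using B ug.block_sets_subset by blast
  then have V: "x \<in> V" "y \<in> V" using xy by auto
  show False
  proof (rule no_invariant_bipartition[OF prim, of \<kappa>])
    fix D assume D: "D \<in> ug.block_sets"
    obtain g where g: "aut g" "g ` B = D" using primitive_transitive_on_blocks[OF prim B D] by blast
    have "\<kappa> D (g x)" using g by (auto simp: \<kappa>_def)
    moreover have "\<not> \<kappa> D (g y)"
    proof
      assume "\<kappa> D (g y)"
      then obtain h where h: "aut h" "h ` B = D" "h x = g y" unfolding \<kappa>_def by (elim exE conjE)
      obtain f where f: "aut f \<and> (\<forall>v\<in>V. g (f v) = h v) \<and> (\<forall>S T. S \<subseteq> V \<longrightarrow> T \<subseteq> V \<longrightarrow> h ` S = g ` T \<longrightarrow> f ` S = T)"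
        using aut_quotient[OF g(1) h(1)] by (elim exE)
      have "f ` B = B" using f BV g h by simp
      moreover have "f x = y"
      proof -
        have "f x \<in> V" using f V arc_iso_in by metis
        moreover have "g (f x) = g y" using f V h by simp
        ultimately show ?thesis using arc_iso_eq_iff[OF g(1)] V by blast
      qed
      ultimately show False using neg f by blast
    qed
    moreover have "g x \<in> D" "g y \<in> D" using g xy by auto
    ultimately show "(\<exists>x\<in>D. \<kappa> D x) \<and> (\<exists>x\<in>D. \<not> \<kappa> D x)" by blast
  next
    fix D g u v assume D: "D \<in> ug.block_sets" and g: "aut g" and uv: "u \<in> D" "v \<in> D"
    have DV: "D \<subseteq> V" using D ug.block_sets_subset by blast
    have "\<kappa> (g ` D) (g w) \<longleftrightarrow> \<kappa> D w" if w: "w \<in> D" for w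
    proof
      assume "\<kappa> D w"
      then obtain h where h: "aut h" "h ` B = D" "h x = w" unfolding \<kappa>_def by (elim exE conjE)
      have "(\<lambda>v. g (h v)) ` B = g ` D" unfolding h(2)[symmetric] by (simp add: image_image)
      then show "\<kappa> (g ` D) (g w)"
        using arc_iso_comp[OF h(1) g] h(3) unfolding \<kappa>_def by (intro exI[of _ "\<lambda>v. g (h v)"]) simp
    next
      assume "\<kappa> (g ` D) (g w)"
      then obtain h where h: "aut h" "h ` B = g ` D" "h x = g w" unfolding \<kappa>_def by (elim exE conjE)
      obtain f where f: "aut f \<and> (\<forall>v\<in>V. g (f v) = h v) \<and> (\<forall>S T. S \<subseteq> V \<longrightarrow> T \<subseteq> V \<longrightarrow> h ` S = g ` T \<longrightarrow> f ` S = T)"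
        using aut_quotient[OF g h(1)] by (elim exE)
      have "f ` B = D" using f BV DV h by simp
      moreover have "f x = w"
      proof -
        have "f x \<in> V" using f V arc_iso_in by metis
        moreover have "g (f x) = g w" using f V h by simp
        ultimately show ?thesis using arc_iso_eq_iff[OF g] w DV by blast
      qed
      ultimately show "\<kappa> D w" using f unfolding \<kappa>_def by (intro exI[of _ f]) simp
    qed
    then show "(\<kappa> (g ` D) (g u) = \<kappa> (g ` D) (g v)) = (\<kappa> D u = \<kappa> D v)" using uv by simp
  qed
qed

lemma primitive_flag_transitive:
  assumes prim: "primitive_graph \<Gamma>" and D: "D \<in> ug.block_sets" "D' \<in> ug.block_sets"
    and x: "x \<in> D" "x' \<in> D'"
  shows "\<exists>g. aut g \<and> g ` D = D' \<and> g x = x'"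
proof -
  obtain g where g: "aut g" "g ` D = D'" using primitive_transitive_on_blocks[OF prim D] by blast
  have "g x \<in> D'" using g x by blast
  then obtain h where h: "aut h" "h ` D' = D'" "h (g x) = x'"
    using primitive_transitive_within_block[OF prim D(2) _ x(2)] by metis
  have "(\<lambda>v. h (g v)) ` D = D'" using h(2) unfolding g(2)[symmetric] by (simp add: image_image)
  then show ?thesis using arc_iso_comp[OF g(1) h(1)] h(3) by (intro exI[of _ "\<lambda>v. h (g v)"]) simp
qed

lemma primitive_homogeneous_blocks:
  assumes prim: "primitive_graph \<Gamma>"
  shows homogeneous_blocks
  unfolding homogeneous_blocks_def
proof (intro ballI)
  fix D D' x x' assume D: "D \<in> ug.block_sets" "D' \<in> ug.block_sets" and "x \<in> D" "x' \<in> D'"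
  then obtain g where g: "aut g" "g ` D = D'" "g x = x'"
    using primitive_flag_transitive[OF prim] by metis
  then show "\<exists>f. isom f D D' \<and> f x = x'" using aut_isom_block[OF g(1) D(1)] by (intro exI[of _ g]) simp
qed

text \<open>
  Blocks with two vertices are divided into two single vertices; the digraph
  is then a tree, and being at even distance is an invariant equivalence relation.
\<close>

lemma primitive_imp_three_vertices:
  assumes prim: "primitive_graph \<Gamma>" and B: "B \<in> ug.block_sets" and fin: "finite B"
  shows "3 \<le> card B"
proof (rule ccontr)
  assume "\<not> 3 \<le> card B"
  obtain x y where xy: "x \<in> B" "y \<in> B" "x \<noteq> y" using block_two[OF B] by blast
  have "card {x, y} \<le> card B" using xy fin by (intro card_mono) auto
  then have B2: "card B = 2" using \<open>\<not> 3 \<le> card B\<close> xy(3) by simp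
  have two: "card E = 2" if E: "E \<in> ug.block_sets" for E
  proof -
    obtain g where g: "aut g" "g ` B = E" using primitive_transitive_on_blocks[OF prim B E] by blast
    have "card (g ` B) = card B"
      by (intro card_image bij_betw_imp_inj_on[OF arc_iso_bij[OF aut_isom_block[OF g(1) B]]])
    then show ?thesis using g B2 by simp
  qed
  define \<kappa> where "\<kappa> = (\<lambda>E v. v = (SOME w::'a. w \<in> E))"
  have \<kappa>: "\<kappa> E u = \<kappa> E v \<longleftrightarrow> u = v" if E: "E \<in> ug.block_sets" "u \<in> E" "v \<in> E" for E u v
  proof
    assume eq: "\<kappa> E u = \<kappa> E v"
    let ?w = "SOME w. w \<in> E"
    have w: "?w \<in> E" using E(2) by (rule someI)
    show "u = v"
    proof (rule ccontr)
      assume "u \<noteq> v"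
      then have "u \<noteq> ?w" "v \<noteq> ?w" using eq by (auto simp: \<kappa>_def)
      then have "card {u, v, ?w} = 3" using \<open>u \<noteq> v\<close> by simp
      moreover have "finite E" using two[OF E(1)] by (intro card_ge_0_finite) simp
      ultimately have "3 \<le> card E" using E w card_mono[of E "{u, v, ?w}"] by simp
      then show False using two[OF E(1)] by simp
    qed
  qed simp
  show False
  proof (rule no_invariant_bipartition[OF prim, of \<kappa>])
    fix D assume D: "D \<in> ug.block_sets"
    obtain u v where "u \<in> D" "v \<in> D" "u \<noteq> v" using block_two[OF D] by blast
    then have "\<kappa> D u \<noteq> \<kappa> D v" using \<kappa>[OF D] by simp
    then show "(\<exists>x\<in>D. \<kappa> D x) \<and> (\<exists>x\<in>D. \<not> \<kappa> D x)" using \<open>u \<in> D\<close> \<open>v \<in> D\<close> by blast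
  next
    fix D g u v assume D: "D \<in> ug.block_sets" and g: "aut g" and uv: "u \<in> D" "v \<in> D"
    have "\<kappa> (g ` D) (g u) = \<kappa> (g ` D) (g v) \<longleftrightarrow> g u = g v"
      by (rule \<kappa>[OF automorphism_block[OF g D] imageI[OF uv(1)] imageI[OF uv(2)]])
    also have "\<dots> \<longleftrightarrow> u = v" using arc_iso_eq_iff[OF g] uv ug.block_setsD[OF D] by blast
    also have "\<dots> \<longleftrightarrow> \<kappa> D u = \<kappa> D v" by (rule \<kappa>[OF D uv, symmetric])
    finally show "(\<kappa> (g ` D) (g u) = \<kappa> (g ` D) (g v)) = (\<kappa> D u = \<kappa> D v)" .
  qed
qed

lemma homogeneous_vertex_transitive:
  assumes "homogeneous_blocks" "B \<in> ug.block_sets"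
  shows "vertex_transitive (induced \<Gamma> B)"
  using assms unfolding vertex_transitive_induced homogeneous_blocks_def by simp

text \<open>
  Automorphisms of the digraph carry an invariant relation on one block to all others, so that
  \<open>invariant_block_relations_trivial\<close> applies.
\<close>

lemma primitive_imp_primitive_block:
  assumes prim: "primitive_graph \<Gamma>" and B: "B \<in> ug.block_sets"
  shows "primitive_graph (induced \<Gamma> B)"
  unfolding primitive_graph_induced
proof (intro conjI allI impI)
  show "vertex_transitive (induced \<Gamma> B)"
    by (rule homogeneous_vertex_transitive[OF primitive_homogeneous_blocks[OF prim] B])
  fix r assume r: "invariant_equiv (parcs \<Gamma>) B r"
  then have eq: "r \<subseteq> B \<times> B" "refl_on B r" "sym r" "trans r"
    and inv: "\<And>f x y. isom f B B \<Longrightarrow> (x, y) \<in> r \<Longrightarrow> (f x, f y) \<in> r"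
    by (simp_all add: invariant_equiv_def equiv_def)
  have BV: "B \<subseteq> V" using B ug.block_sets_subset by blast
  define \<rho> where "\<rho> = (\<lambda>E. {p. \<exists>g u v. p = (g u, g v) \<and> aut g \<and> g ` B = E \<and> (u, v) \<in> r})"
  have \<rho>I: "(g u, g v) \<in> \<rho> E" if "aut g" "g ` B = E" "(u, v) \<in> r" for g u v E
    unfolding \<rho>_def using that by blast
  \<comment> \<open>Any two automorphisms taking \<open>B\<close> to \<open>E\<close> transport \<open>r\<close> to the same relation on \<open>E\<close>.\<close>
  have \<rho>_iff: "(g u, g v) \<in> \<rho> E \<longleftrightarrow> (u, v) \<in> r" if g: "aut g" "g ` B = E" and uv: "u \<in> B" "v \<in> B" for g u v E
  proof
    assume "(g u, g v) \<in> \<rho> E"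
    then obtain h u' v' where h: "g u = h u'" "g v = h v'" "aut h" "h ` B = E" "(u', v') \<in> r"
      unfolding \<rho>_def by auto
    have u'v': "u' \<in> B" "v' \<in> B" using h(5) eq(1) by auto
    obtain f where f: "aut f \<and> (\<forall>v\<in>V. g (f v) = h v) \<and> (\<forall>S T. S \<subseteq> V \<longrightarrow> T \<subseteq> V \<longrightarrow> h ` S = g ` T \<longrightarrow> f ` S = T)"
      using aut_quotient[OF g(1) h(3)] by (elim exE)
    have fB: "f ` B = B" using f BV g(2) h(4) by simp
    then have "isom f B B" using aut_isom_block[of f B] f B by simp
    then have "(f u', f v') \<in> r" using h(5) by (rule inv)
    moreover have "f w' = w" if "w' \<in> B" "w \<in> B" "g w = h w'" for w w'
    proof -
      have "f w' \<in> B" using fB that(1) by blast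
      moreover have "g (f w') = g w" using f BV that by auto
      ultimately show ?thesis using arc_iso_eq_iff[OF g(1)] that(2) BV by blast
    qed
    ultimately show "(u, v) \<in> r" using u'v' uv h(1,2) by simp
  qed (rule \<rho>I[OF g])
  have "(\<forall>E\<in>ug.block_sets. \<rho> E = Id_on E) \<or> (\<forall>E\<in>ug.block_sets. \<rho> E = E \<times> E)"
  proof (rule invariant_block_relations_trivial[OF prim])
    fix E assume E: "E \<in> ug.block_sets"
    obtain g where g: "aut g" "g ` B = E" using primitive_transitive_on_blocks[OF prim B E] by blast
    have sub: "\<rho> E \<subseteq> E \<times> E" using eq(1) unfolding \<rho>_def by blast
    have lift: "\<exists>u\<in>B. a = g u" if "a \<in> E" for a using that g(2) by blast
    show "equiv E (\<rho> E)"
    proof (rule equivI[OF sub])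
      show "refl_on E (\<rho> E)"
      proof (rule refl_onI)
        fix a assume "a \<in> E"
        then obtain u where "u \<in> B" "a = g u" using lift by blast
        then show "(a, a) \<in> \<rho> E" using \<rho>I[OF g] eq(2) by (simp add: refl_on_def)
      qed
      show "sym (\<rho> E)"
      proof (rule symI)
        fix a b assume ab: "(a, b) \<in> \<rho> E"
        then obtain u v where uv: "u \<in> B" "v \<in> B" "a = g u" "b = g v" using lift sub by blast
        then have "(u, v) \<in> r" using \<rho>_iff[OF g uv(1,2)] ab by simp
        then show "(b, a) \<in> \<rho> E" using \<rho>I[OF g symD[OF eq(3)]] uv by simp
      qed
      show "trans (\<rho> E)"
      proof (rule transI)
        fix a b c assume ab: "(a, b) \<in> \<rho> E" and bc: "(b, c) \<in> \<rho> E"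
        obtain u v where uv: "u \<in> B" "v \<in> B" "a = g u" "b = g v" using ab lift sub by blast
        obtain w where w: "w \<in> B" "c = g w" using bc lift sub by blast
        have "(u, v) \<in> r" "(v, w) \<in> r"
          using \<rho>_iff[OF g uv(1,2)] \<rho>_iff[OF g uv(2) w(1)] ab bc uv w by simp_all
        then have "(u, w) \<in> r" by (rule transD[OF eq(4)])
        then show "(a, c) \<in> \<rho> E" using \<rho>I[OF g] uv w by simp
      qed
    qed
  next
    fix E g a b assume E: "E \<in> ug.block_sets" and g: "aut g" and ab: "(a, b) \<in> \<rho> E"
    then obtain h u v where h: "a = h u" "b = h v" "aut h" "h ` B = E" "(u, v) \<in> r"
      unfolding \<rho>_def by auto
    have "(\<lambda>v. g (h v)) ` B = g ` E" unfolding h(4)[symmetric] by (simp add: image_image)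
    then show "(g a, g b) \<in> \<rho> (g ` E)"
      using \<rho>I[OF arc_iso_comp[OF h(3) g] _ h(5)] h(1,2) by simp
  qed
  moreover have "\<rho> B = r"
  proof (intro equalityI subrelI)
    fix a b assume ab: "(a, b) \<in> \<rho> B"
    then have "a \<in> B" "b \<in> B" using eq(1) unfolding \<rho>_def by blast+
    then show "(a, b) \<in> r" using \<rho>_iff[OF arc_iso_id, of B a b] ab by simp
  next
    fix a b assume "(a, b) \<in> r"
    then show "(a, b) \<in> \<rho> B" using \<rho>I[OF arc_iso_id, of B a b] by simp
  qed
  ultimately show "r = Id_on B \<or> r = B \<times> B" using B by blast
qed

text \<open>
  Regularity says that an isomorphism from a block to \<open>B\<close> is determined by the image of one vertex,
  so that all blocks are folded onto \<open>B\<close> by isomorphisms.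
\<close>

lemma primitive_imp_block_not_regular:
  assumes prim: "primitive_graph \<Gamma>" and B: "B \<in> ug.block_sets"
  shows "\<not> automorphism_regular (induced \<Gamma> B)"
proof
  assume "automorphism_regular (induced \<Gamma> B)"
  then have reg: "f y = y" if "isom f B B" "x \<in> B" "f x = x" "y \<in> B" for f x y
    using that unfolding automorphism_regular_induced by blast
  have hom: "\<exists>f. isom f D D' \<and> f x = x'" if "D \<in> ug.block_sets" "D' \<in> ug.block_sets" "x \<in> D" "x' \<in> D'" for D D' x x'
    using primitive_homogeneous_blocks[OF prim] that unfolding homogeneous_blocks_def by simp
  obtain b1 b2 where b: "b1 \<in> B" "b2 \<in> B" "b1 \<noteq> b2" using block_two[OF B] by blast
  define \<Phi> where "\<Phi> = (\<lambda>D. {f. isom f D B})"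
  show False
  proof (rule no_invariant_folding[OF prim, where T = B and \<Phi> = \<Phi>, OF _ _ _ _ _ b])
    fix D x t assume D: "D \<in> ug.block_sets" "x \<in> D" "t \<in> B"
    obtain f where "isom f D B \<and> f x = t" using hom[OF D(1) B D(2,3)] by (elim exE)
    then show "\<exists>\<phi>\<in>\<Phi> D. \<phi> x = t" by (intro bexI[of _ f]) (simp_all add: \<Phi>_def)
  next
    fix D \<phi> \<psi> x y assume D: "D \<in> ug.block_sets" "\<phi> \<in> \<Phi> D" "\<psi> \<in> \<Phi> D" "x \<in> D" "y \<in> D" "\<phi> x = \<psi> x"
    then have iso: "isom \<phi> D B" "isom \<psi> D B" by (simp_all add: \<Phi>_def)
    let ?f = "\<lambda>v. \<psi> (inv_into D \<phi> v)"
    have "isom ?f B B" by (rule arc_iso_comp[OF arc_iso_inv[OF iso(1)] iso(2)])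
    moreover have "\<phi> x \<in> B" "\<phi> y \<in> B" by (rule arc_iso_in[OF iso(1) D(4)], rule arc_iso_in[OF iso(1) D(5)])
    moreover have "?f (\<phi> x) = \<phi> x" using arc_iso_inv_left[OF iso(1) D(4)] D(6) by simp
    ultimately have "?f (\<phi> y) = \<phi> y" using reg[of ?f "\<phi> x" "\<phi> y"] by simp
    then show "\<phi> y = \<psi> y" using arc_iso_inv_left[OF iso(1) D(5)] by simp
  next
    fix D g \<phi> assume "D \<in> ug.block_sets" "aut g" "\<phi> \<in> \<Phi> (g ` D)"
    then show "(\<lambda>x. \<phi> (g x)) \<in> \<Phi> D"
      using arc_iso_comp[OF aut_isom_block[of g D]] by (simp add: \<Phi>_def)
  next
    fix t t' assume t: "t \<in> B" "t' \<in> B"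
    obtain a where a: "isom a B B \<and> a t = t'" using hom[OF B B t] by (elim exE)
    show "\<exists>a. a t = t' \<and> (\<forall>D\<in>ug.block_sets. \<forall>\<phi>\<in>\<Phi> D. (\<lambda>x. a (\<phi> x)) \<in> \<Phi> D)"
    proof (intro exI[of _ a] conjI ballI)
      show "a t = t'" using a by simp
      fix D \<phi> assume "\<phi> \<in> \<Phi> D"
      then show "(\<lambda>x. a (\<phi> x)) \<in> \<Phi> D" using a arc_iso_comp[of _ \<phi> D B a B] by (simp add: \<Phi>_def)
    qed
  next
    fix D \<phi> assume "\<phi> \<in> \<Phi> D"
    then show "\<phi> ` D = B" using arc_iso_image by (simp add: \<Phi>_def)
  qed
qed

section \<open>Digraphs with primitive blocks\<close>

text \<open>
  Suppose that every automorphism fixing \<open>z\<close> fixes \<open>x\<close>. Then \<open>g z \<mapsto> g x\<close> is a well defined equivariant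
  map \<open>\<pi>\<close>. By primitivity it is injective, so that conversely every automorphism fixing \<open>x\<close> fixes
  \<open>z\<close>; for an infinite block this does not follow by counting. Now having the same stabiliser is an
  invariant equivalence relation that relates \<open>z\<close> and \<open>x\<close>, so all stabilisers agree and are
  trivial.
\<close>

lemma primitive_not_regular_moves:
  assumes prim: "primitive_graph (induced \<Gamma> B)" and nreg: "\<not> automorphism_regular (induced \<Gamma> B)"
    and zx: "z \<in> B" "x \<in> B" "z \<noteq> x"
  shows "\<exists>\<alpha>. isom \<alpha> B B \<and> \<alpha> z = z \<and> \<alpha> x \<noteq> x"
proof (rule ccontr)
  assume neg: "\<not> ?thesis"
  have trans: "\<exists>f. isom f B B \<and> f u = v" if "u \<in> B" "v \<in> B" for u v
    using prim that unfolding primitive_graph_induced vertex_transitive_induced by simp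
  have trivial: "r = Id_on B \<or> r = B \<times> B" if "invariant_equiv (parcs \<Gamma>) B r" for r
    using prim that unfolding primitive_graph_induced by simp
  have fixes_x: "f x = x" if f: "isom f B B" "f z = z" for f
  proof (rule ccontr)
    assume "f x \<noteq> x"
    then have "isom f B B \<and> f z = z \<and> f x \<noteq> x" using f by (intro conjI)
    then have "\<exists>\<alpha>. isom \<alpha> B B \<and> \<alpha> z = z \<and> \<alpha> x \<noteq> x" by (rule exI[of _ f])
    with neg show False by (rule notE)
  qed
  define \<pi> where "\<pi> = (\<lambda>u. (SOME g. isom g B B \<and> g z = u) x)"
  have \<pi>: "\<pi> (g z) = g x" if g: "isom g B B" for g
  proof -
    define h where "h = (SOME h. isom h B B \<and> h z = g z)"
    have "\<exists>h. isom h B B \<and> h z = g z" using g by (intro exI[of _ g]) simp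
    then have "isom h B B \<and> h z = g z" unfolding h_def by (rule someI_ex)
    then have h: "isom h B B" "h z = g z" by (rule conjunct1, rule conjunct2)
    let ?k = "\<lambda>v. inv_into B g (h v)"
    have "isom ?k B B" by (rule arc_iso_comp[OF h(1) arc_iso_inv[OF g]])
    moreover have "?k z = z" using h(2) arc_iso_inv_left[OF g zx(1)] by simp
    ultimately have "?k x = x" by (rule fixes_x)
    then have "g (?k x) = g x" by simp
    moreover have "h x \<in> B" by (rule arc_iso_in[OF h(1) zx(2)])
    ultimately have "h x = g x" using arc_iso_inv_right[OF g] by simp
    then show ?thesis by (simp add: \<pi>_def h_def)
  qed
  have \<pi>z: "\<pi> z = x" using \<pi>[OF arc_iso_id] .
  have \<pi>_equivariant: "\<pi> (f u) = f (\<pi> u)" if f: "isom f B B" and u: "u \<in> B" for f u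
  proof -
    obtain g where g: "isom g B B \<and> g z = u" using trans[OF zx(1) u] by (elim exE)
    then have "isom (\<lambda>v. f (g v)) B B" using arc_iso_comp[OF _ f] by simp
    then have "\<pi> (f (g z)) = f (g x)" by (rule \<pi>)
    then show ?thesis using \<pi>[of g] g by simp
  qed
  define K where "K = {(u, v). u \<in> B \<and> v \<in> B \<and> \<pi> u = \<pi> v}"
  have "invariant_equiv (parcs \<Gamma>) B K"
    unfolding invariant_equiv_def
  proof (intro conjI allI impI)
    show "equiv B K" by (auto simp: K_def equiv_def refl_on_def sym_def trans_def)
    fix f u v assume f: "isom f B B" and "(u, v) \<in> K"
    then have uv: "u \<in> B" "v \<in> B" "\<pi> u = \<pi> v" by (simp_all add: K_def)
    then have "\<pi> (f u) = \<pi> (f v)" using \<pi>_equivariant[OF f] by simp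
    then show "(f u, f v) \<in> K" using uv arc_iso_in[OF f] by (simp add: K_def)
  qed
  then have K: "K = Id_on B"
  proof (rule trivial[THEN disjE])
    assume all: "K = B \<times> B"
    obtain g where g: "isom g B B \<and> g x = z" using trans[OF zx(2,1)] by (elim exE)
    then have "g z \<in> B" using arc_iso_in[OF _ zx(1)] by (elim conjE)
    then have "(z, g z) \<in> K" using all zx by simp
    then have "\<pi> (g z) = x" using \<pi>z by (simp add: K_def)
    then have "z = x" using \<pi>[of g] g by simp
    then show ?thesis using zx by simp
  qed
  have conv: "f z = z" if f: "isom f B B" and "f x = x" for f
  proof -
    have "\<pi> (f z) = \<pi> z" using \<pi>[OF f] \<pi>z that(2) by simp
    then have "(f z, z) \<in> K" using arc_iso_in[OF f zx(1)] zx by (simp add: K_def)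
    then show ?thesis using K by auto
  qed
  define F where "F = {(u, v). u \<in> B \<and> v \<in> B \<and> (\<forall>f. isom f B B \<longrightarrow> (f u = u \<longleftrightarrow> f v = v))}"
  have "invariant_equiv (parcs \<Gamma>) B F"
    unfolding invariant_equiv_def
  proof (intro conjI allI impI)
    show "equiv B F" by (auto simp: F_def equiv_def refl_on_def sym_def trans_def)
    fix g u v assume g: "isom g B B" and "(u, v) \<in> F"
    then have *: "u \<in> B \<and> v \<in> B \<and> (\<forall>f. isom f B B \<longrightarrow> (f u = u \<longleftrightarrow> f v = v))"
      unfolding F_def mem_Collect_eq prod.case by (elim conjE) (intro conjI)
    note uv = conjunct1[OF *] conjunct1[OF conjunct2[OF *]]
      and uvF = conjunct2[OF conjunct2[OF *]]
    have "f (g u) = g u \<longleftrightarrow> f (g v) = g v" if f: "isom f B B" for f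
    proof -
      let ?k = "\<lambda>w. inv_into B g (f (g w))"
      have "isom ?k B B" by (rule arc_iso_comp[OF arc_iso_comp[OF g f] arc_iso_inv[OF g]])
      moreover have "?k w = w \<longleftrightarrow> f (g w) = g w" if w: "w \<in> B" for w
      proof
        assume "?k w = w"
        then have "g (?k w) = g w" by simp
        then show "f (g w) = g w" using arc_iso_inv_right[OF g arc_iso_in[OF f arc_iso_in[OF g w]]] by simp
      next
        assume "f (g w) = g w" then show "?k w = w" using arc_iso_inv_left[OF g w] by simp
      qed
      ultimately show ?thesis using uvF[rule_format, of ?k] uv by simp
    qed
    then show "(g u, g v) \<in> F" using arc_iso_in[OF g] uv by (simp add: F_def)
  qed
  then have "F = Id_on B \<or> F = B \<times> B" by (rule trivial)
  moreover have "(z, x) \<in> F"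
    unfolding F_def mem_Collect_eq prod.case using zx fixes_x conv by (intro conjI allI impI iffI)
  ultimately have F: "F = B \<times> B" using zx by auto
  have "\<forall>f. \<forall>u\<in>B. isom f B B \<longrightarrow> f u = u \<longrightarrow> (\<forall>v\<in>B. f v = v)"
  proof (intro allI ballI impI)
    fix f u v assume f: "isom f B B" "f u = u" and "u \<in> B" "v \<in> B"
    then have "(u, v) \<in> F" using F by simp
    then have "\<forall>f. isom f B B \<longrightarrow> (f u = u \<longleftrightarrow> f v = v)"
      unfolding F_def mem_Collect_eq prod.case by (elim conjE)
    then show "f v = v" using f by simp
  qed
  then have "automorphism_regular (induced \<Gamma> B)"
    using prim unfolding automorphism_regular_induced primitive_graph_induced by (intro conjI) (elim conjE)
  with nreg show False by (rule notE)
qed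

text \<open>
  Let \<open>r\<close> relate \<open>x\<close> to another vertex \<open>y\<close>, and let \<open>B\<close> be the block at \<open>x\<close> that leads towards \<open>y\<close>.
  An automorphism that moves \<open>x\<close> within \<open>B\<close> and fixes everything behind the gate of \<open>y\<close> relates \<open>x\<close>
  to another vertex of \<open>B\<close>. So \<open>r\<close> is universal on \<open>B\<close>, hence on all blocks, hence everywhere.
\<close>

theorem primitive_from_blocks:
  assumes prim: "\<And>B. B \<in> ug.block_sets \<Longrightarrow> primitive_graph (induced \<Gamma> B)"
    and nreg: "\<And>B. B \<in> ug.block_sets \<Longrightarrow> \<not> automorphism_regular (induced \<Gamma> B)"
    and isos: "\<And>B B'. B \<in> ug.block_sets \<Longrightarrow> B' \<in> ug.block_sets \<Longrightarrow> \<exists>f. isom f B B'"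
  shows "primitive_graph \<Gamma>"
proof -
  have hom: homogeneous_blocks
    unfolding homogeneous_blocks_def
  proof (intro ballI)
    fix D D' x x' assume D: "D \<in> ug.block_sets" "D' \<in> ug.block_sets" and x: "x \<in> D" "x' \<in> D'"
    obtain f where f: "isom f D D'" using isos[OF D] by (elim exE)
    have "\<forall>u\<in>D'. \<forall>v\<in>D'. \<exists>a. isom a D' D' \<and> a u = v"
      using prim[OF D(2)] unfolding primitive_graph_induced vertex_transitive_induced by (elim conjE)
    then have "\<exists>a. isom a D' D' \<and> a (f x) = x'" using arc_iso_in[OF f x(1)] x(2) by simp
    then obtain a where a: "isom a D' D' \<and> a (f x) = x'" by (elim exE)
    then show "\<exists>f. isom f D D' \<and> f x = x'"
      using arc_iso_comp[OF f, of a D'] by (intro exI[of _ "\<lambda>v. a (f v)"]) simp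
  qed
  have "r = Id_on V \<or> r = V \<times> V" if r: "invariant_equiv (parcs \<Gamma>) V r" for r
  proof (rule disjCI)
    assume "r \<noteq> V \<times> V"
    have req: "r \<subseteq> V \<times> V" "refl_on V r" "sym r" "trans r"
      and inv: "\<And>g u v. aut g \<Longrightarrow> (u, v) \<in> r \<Longrightarrow> (g u, g v) \<in> r"
      using r by (simp_all add: invariant_equiv_def equiv_def)
    show "r = Id_on V"
    proof (rule ccontr)
      assume "r \<noteq> Id_on V"
      have "Id_on V \<subseteq> r" using req(2) by (auto simp: refl_on_def)
      then have "\<not> r \<subseteq> Id_on V" using \<open>r \<noteq> Id_on V\<close> by simp
      then obtain p where "p \<in> r" "p \<notin> Id_on V" unfolding subset_iff by blast
      then obtain x y where xy: "(x, y) \<in> r" "x \<noteq> y" "x \<in> V" "y \<in> V"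
        using req(1) by (cases p) auto
      obtain B where B: "B \<in> ug.block_sets" "x \<in> B" "ug.gate B y \<noteq> x"
        using ug.exists_block_towards[OF xy(3,4,2)] by (elim bexE conjE)
      let ?z = "ug.gate B y"
      have z: "?z \<in> B" by (rule ug.gate_in[OF B(1) xy(4)])
      have BV: "B \<subseteq> V" using B ug.block_sets_subset by blast
      obtain \<alpha> where \<alpha>: "isom \<alpha> B B \<and> \<alpha> ?z = ?z \<and> \<alpha> x \<noteq> x"
        using primitive_not_regular_moves[OF prim[OF B(1)] nreg[OF B(1)] z B(2,3)] by (elim exE)
      then have \<alpha>': "isom \<alpha> B B" "\<alpha> ?z = ?z" by simp_all
      obtain g where g: "aut g \<and> (\<forall>v\<in>B. g v = \<alpha> v) \<and> (\<forall>v\<in>V. ug.gate B v = ?z \<longrightarrow> g v = v)"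
        using extend_block_automorphism_fixing_branch[OF hom B(1) \<alpha>'(1) z \<alpha>'(2)] by (elim exE)
      then have ga: "aut g" and "g x = \<alpha> x" "g y = y" using B(2) xy(4) by simp_all
      then have "(\<alpha> x, y) \<in> r" using inv[OF ga xy(1)] by simp
      then have moved: "(\<alpha> x, x) \<in> r" by (rule transD[OF req(4) _ symD[OF req(3) xy(1)]])
      have "invariant_equiv (parcs \<Gamma>) B (r \<inter> B \<times> B)"
        unfolding invariant_equiv_def
      proof (intro conjI allI impI)
        show "equiv B (r \<inter> B \<times> B)"
        proof (rule equivI)
          show "refl_on B (r \<inter> B \<times> B)" using req(2) BV by (auto simp: refl_on_def)
          show "sym (r \<inter> B \<times> B)" using req(3) by (auto simp: sym_def)
          show "trans (r \<inter> B \<times> B)" by (rule transI) (use transD[OF req(4)] in auto)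
        qed auto
        fix f u v assume f: "isom f B B" and uv: "(u, v) \<in> r \<inter> B \<times> B"
        obtain h where h: "aut h \<and> (\<forall>v\<in>B. h v = f v)"
          using extend_block_isomorphism[OF hom B(1) B(1) f] by (elim exE)
        have uvB: "(u, v) \<in> r" "u \<in> B" "v \<in> B" using uv by simp_all
        have "h u = f u" "h v = f v" using h uvB(2,3) by simp_all
        then have "(f u, f v) \<in> r" using inv[OF conjunct1[OF h] uvB(1)] by simp
        then show "(f u, f v) \<in> r \<inter> B \<times> B" using arc_iso_in[OF f] uvB(2,3) by simp
      qed
      moreover have "\<forall>s. invariant_equiv (parcs \<Gamma>) B s \<longrightarrow> s = Id_on B \<or> s = B \<times> B"
        using prim[OF B(1)] unfolding primitive_graph_induced by (elim conjE)
      ultimately have "r \<inter> B \<times> B = Id_on B \<or> r \<inter> B \<times> B = B \<times> B" by (elim allE impE)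
      moreover have "r \<inter> B \<times> B \<noteq> Id_on B"
      proof
        assume eq: "r \<inter> B \<times> B = Id_on B"
        have "(\<alpha> x, x) \<in> r \<inter> B \<times> B" using moved B(2) arc_iso_in[OF \<alpha>'(1) B(2)] by simp
        then have "\<alpha> x = x" unfolding eq by (rule Id_onE) simp
        then show False using \<alpha> by simp
      qed
      ultimately have rB: "B \<times> B \<subseteq> r" by blast
      have rC: "(u, v) \<in> r" if C: "C \<in> ug.block_sets" and uv: "u \<in> C" "v \<in> C" for C u v
      proof -
        obtain f where f: "isom f B C" using isos[OF B(1) C] by (elim exE)
        obtain h where h: "aut h \<and> (\<forall>v\<in>B. h v = f v)"
          using extend_block_isomorphism[OF hom B(1) C f] by (elim exE)
        obtain u' where "u = f u'" "u' \<in> B" using uv(1) unfolding arc_iso_image[OF f, symmetric] by (rule imageE)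
        moreover obtain v' where "v = f v'" "v' \<in> B"
          using uv(2) unfolding arc_iso_image[OF f, symmetric] by (rule imageE)
        ultimately have u'v': "u' \<in> B" "v' \<in> B" "u = f u'" "v = f v'" by simp_all
        have "(u', v') \<in> r" using rB u'v'(1,2) by blast
        then have "(h u', h v') \<in> r" by (rule inv[OF conjunct1[OF h]])
        moreover have "h u' = u" "h v' = v" using h u'v' by simp_all
        ultimately show ?thesis by simp
      qed
      have "(x, v) \<in> r" if v: "v \<in> V" for v
      proof (rule ug.block_induct[OF xy(3) _ _ v])
        show "(x, x) \<in> r" using req(2) xy(3) by (simp add: refl_on_def)
        show "(x, w) \<in> r" if "D \<in> ug.block_sets" "u \<in> D" "w \<in> D" "(x, u) \<in> r" for D u w
          using transD[OF req(4) that(4) rC[OF that(1-3)]] .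
      qed
      then have "(u, v) \<in> r" if "u \<in> V" "v \<in> V" for u v
        using transD[OF req(4) symD[OF req(3)], of x u v] that by simp
      then have "V \<times> V \<subseteq> r" by (intro subrelI) simp
      then have "r = V \<times> V" using req(1) by (intro equalityI)
      then show False using \<open>r \<noteq> V \<times> V\<close> by simp
    qed
  qed
  then show ?thesis
    using primitive_graph_induced[of \<Gamma> V] transitive by (simp add: induced_pverts)
qed

end

theorem theorem3p3:
  fixes \<Gamma> :: "'a pair_pre_digraph"
  assumes "pair_loopfree_digraph \<Gamma>"
    and "vertex_transitive \<Gamma>"
    and "connectivity_one (with_proj \<Gamma>)"
  shows "primitive_graph \<Gamma> \<longleftrightarrow>
    (\<forall>B \<in> blocks \<Gamma>. primitive_graph B \<and> \<not> automorphism_regular B) \<and>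
    (\<forall>B \<in> blocks \<Gamma>. \<forall>B' \<in> blocks \<Gamma>. digraph_iso (with_proj B) (with_proj B')) \<and>
    (\<forall>B \<in> blocks \<Gamma>. finite (pverts B) \<longrightarrow> 3 \<le> card (pverts B))"
    (is "?prim \<longleftrightarrow> ?blocks")
proof -
  interpret connectivity_one_digraph \<Gamma> using assms by (rule connectivity_one_digraph.intro)
  show ?thesis
  proof
    assume prim: ?prim
    have "\<exists>f. isom f B B'" if B: "B \<in> ug.block_sets" "B' \<in> ug.block_sets" for B B'
    proof -
      obtain g where "aut g" "g ` B = B'" using primitive_transitive_on_blocks[OF prim B] by blast
      then show ?thesis using aut_isom_block[of g B] B by (intro exI[of _ g]) simp
    qed
    then show ?blocks
      using primitive_imp_primitive_block[OF prim] primitive_imp_block_not_regular[OF prim]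
        primitive_imp_three_vertices[OF prim]
      by (simp add: blocks_eq_induced digraph_iso_induced)
  next
    assume ?blocks
    then show ?prim
      by (intro primitive_from_blocks) (simp_all add: blocks_eq_induced digraph_iso_induced)
  qed
qed

end
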